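(* For $n\ge1$ let $P_{n}^{(\mathrm{lpk},\mathrm{ilpk})}(s,t)=\sum_{\pi\in\mathfrak{S}_{n}}s^{\mathrm{lpk}(\pi)}t^{\mathrm{ilpk}(\pi)}$. Then: (a) As formal power series, \[ \frac{1}{(1-s)(1-t)}+\sum_{n=1}^{\infty}\frac{((1+s)(1+t))^{n}}{((1-s)(1-t))^{n+1}}P_{n}^{(\mathrm{lpk},\mathrm{ilpk})}\left(\frac{4s}{(1+s)^{2}},\frac{4t}{(1+t)^{2}}\right)x^{n} =\sum_{i,j=0}^{\infty}\frac{(1+x)^{2ij+i+j}}{(1-x)^{2ij+i+j+1}}s^{i}t^{j}. \] (b) For all $n\geq1$, \[ \frac{((1+s)(1+t))^{n}}{((1-s)(1-t))^{n+1}}P_{n}^{(\mathrm{lpk},\mathrm{ilpk})}\left(\frac{4s}{(1+s)^{2}},\frac{4t}{(1+t)^{2}}\right) =\sum_{i,j=0}^{\infty}\sum_{k=0}^{n}\binom{2ij+i+j}{k}\binom{2ij+i+j+n-k}{n-k}s^{i}t^{j}. \] (c) For all $n\geq1$, \[ \frac{((1+s)(1+t))^{n}}{((1-s)(1-t))^{n+1}}P_{n}^{(\mathrm{lpk},\mathrm{ilpk})}\left(\frac{4s}{(1+s)^{2}},\frac{4t}{(1+t)^{2}}\right) =\frac{1}{n!}\sum_{k=0}^n e(n,k) \frac{B_{k}(s)B_{k}(t)}{(1-s)^{k+1}(1-t)^{k+1}}. \]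
   Context: $\mathfrak{S}_n$ is the symmetric group on $[n]$. For $\pi\in\mathfrak{S}_n$, $i$ with $2\le i\le n-1$ is a peak if $\pi(i-1)<\pi(i)>\pi(i+1)$; $i\in[n-1]$ is a left peak if $i$ is a peak, or if $i=1$ and $\pi(1)>\pi(2)$; $\mathrm{lpk}(\pi)$ is the number of left peaks and $\mathrm{ilpk}(\pi)=\mathrm{lpk}(\pi^{-1})$. The type B Eulerian polynomials $B_n(t)$ are defined by $\frac{B_{n}(t)}{(1-t)^{n+1}}=\sum_{k=0}^{\infty}(2k+1)^{n}t^{k}$ (so $B_0=1$). $e(n,k)$ is the number of permutations in $\mathfrak{S}_n$ with exactly $k$ cycles of odd length (and any number of cycles of even length). *)

theory Defs
  imports
    "HOL-Computational_Algebra.Computational_Algebra"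
    "HOL-Combinatorics.Combinatorics"
begin

unbundle fps_syntax

section \<open>Permutation statistics\<close>

definition peak :: "nat \<Rightarrow> (nat \<Rightarrow> nat) \<Rightarrow> nat \<Rightarrow> bool" where
  "peak n \<pi> i \<longleftrightarrow> 2 \<le> i \<and> i \<le> n - 1 \<and> \<pi> (i - 1) < \<pi> i \<and> \<pi> i > \<pi> (i + 1)"

definition left_peak :: "nat \<Rightarrow> (nat \<Rightarrow> nat) \<Rightarrow> nat \<Rightarrow> bool" where
  "left_peak n \<pi> i \<longleftrightarrow> i \<in> {1..n - 1} \<and> (peak n \<pi> i \<or> i = 1 \<and> \<pi> 1 > \<pi> 2)"

definition lpk :: "nat \<Rightarrow> (nat \<Rightarrow> nat) \<Rightarrow> nat" where
  "lpk n \<pi> = card {i. left_peak n \<pi> i}"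

definition ilpk :: "nat \<Rightarrow> (nat \<Rightarrow> nat) \<Rightarrow> nat" where
  "ilpk n \<pi> = lpk n (inv \<pi>)"

text \<open>The value of the two-variable polynomial at elements of an arbitrary commutative ring.\<close>

definition P_lpk_ilpk :: "nat \<Rightarrow> 'a::comm_ring_1 \<Rightarrow> 'a \<Rightarrow> 'a" where
  "P_lpk_ilpk n u v = (\<Sum>\<pi> | \<pi> permutes {1..n}. u ^ lpk n \<pi> * v ^ ilpk n \<pi>)"

text \<open>The cycles of a permutation are its orbits; fixed points are cycles of length 1.\<close>

definition odd_cycles :: "nat \<Rightarrow> (nat \<Rightarrow> nat) \<Rightarrow> nat set set" where
  "odd_cycles n \<pi> = {C \<in> orbit \<pi> ` {1..n}. odd (card C)}"

definition e_odd :: "nat \<Rightarrow> nat \<Rightarrow> nat" where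
  "e_odd n k = card {\<pi>. \<pi> permutes {1..n} \<and> card (odd_cycles n \<pi>) = k}"


section \<open>Type B Eulerian polynomials\<close>

definition eulerian_B :: "nat \<Rightarrow> rat poly" where
  "eulerian_B n = (THE p. fps_of_poly p / (1 - fps_X) ^ (n + 1) =
                          Abs_fps (\<lambda>k. of_nat (2 * k + 1) ^ n))"

lemma eulerian_B_aux:
  "\<exists>p::rat poly. fps_of_poly p = (1 - fps_X) ^ (n + 1) * Abs_fps (\<lambda>k. of_nat (2 * k + 1) ^ n)"
proof (induction n)
  case 0
  have "(1 - fps_X) * Abs_fps (\<lambda>k. 1 :: rat) = 1"
    by (rule fps_ext) (simp add: algebra_simps)
  then show ?case by (intro exI[of _ 1]) simp
next
  case (Suc n)
  define F :: "rat fps" where "F = Abs_fps (\<lambda>k. of_nat (2 * k + 1) ^ n)"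
  define G :: "rat fps" where "G = Abs_fps (\<lambda>k. of_nat (2 * k + 1) ^ Suc n)"
  obtain p :: "rat poly" where p: "fps_of_poly p = (1 - fps_X) ^ (n + 1) * F"
    using Suc unfolding F_def by blast
  have G: "G = F + 2 * fps_X * fps_deriv F"
  proof (rule fps_ext)
    fix k
    have "(2 * fps_X * fps_deriv F) $ k = 2 * (fps_X * fps_deriv F) $ k"
      by (simp add: mult.assoc numeral_fps_const)
    then show "G $ k = (F + 2 * fps_X * fps_deriv F) $ k"
      by (cases k) (simp_all add: G_def F_def algebra_simps)
  qed
  define q where "q = [:1, of_nat (2 * n + 1):] * p + [:0, 2:] * [:1, - 1:] * pderiv p"
  have lin: "fps_of_poly [:a, b:] = fps_const a + fps_const b * fps_X" for a b :: rat
    by (rule fps_ext) (auto simp: coeff_pCons split: nat.split)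
  have d: "fps_of_poly (pderiv p) =
      (1 - fps_X) ^ (n + 1) * fps_deriv F - of_nat (n + 1) * (1 - fps_X) ^ n * F"
  proof -
    have "fps_of_poly (pderiv p) = fps_deriv (fps_of_poly p)"
      by (simp add: fps_of_poly_pderiv)
    also have "\<dots> = (1 - fps_X) ^ (n + 1) * fps_deriv F +
        fps_deriv ((1 - fps_X) ^ (n + 1)) * F"
      unfolding p by (rule fps_deriv_mult)
    also have "fps_deriv ((1 - fps_X :: rat fps) ^ (n + 1)) = - (of_nat (n + 1) * (1 - fps_X) ^ n)"
      by (subst fps_deriv_power) (simp add: fps_of_nat [symmetric] flip: smult_minus_left)
    finally show ?thesis by simp
  qed
  have "fps_const (of_nat (2 * n + 1) :: rat) = 2 * of_nat n + 1"
    by (metis fps_of_nat of_nat_1 of_nat_add of_nat_mult of_nat_numeral)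
  moreover have "fps_const (2 :: rat) = 2" "fps_const (- 1 :: rat) = - 1"
    by (simp_all add: numeral_fps_const flip: fps_const_neg)
  ultimately have q: "fps_of_poly q = (1 + (2 * of_nat n + 1) * fps_X) * fps_of_poly p +
      2 * fps_X * (1 - fps_X) * fps_of_poly (pderiv p)"
    unfolding q_def fps_of_poly_add fps_of_poly_mult lin by simp
  have "fps_of_poly q = (1 - fps_X) ^ (Suc n + 1) * G"
    unfolding q d p G by (simp add: algebra_simps)
  then show ?case unfolding G_def by blast
qed

lemma eulerian_B:
  "fps_of_poly (eulerian_B n) / (1 - fps_X) ^ (n + 1) = Abs_fps (\<lambda>k. of_nat (2 * k + 1) ^ n)"
proof -
  let ?u = "(1 - fps_X :: rat fps) ^ (n + 1)"
  have u: "?u $ 0 \<noteq> 0" by (simp add: fps_nth_power_0)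
  then have "?u \<noteq> 0" by (metis fps_zero_nth)
  obtain p :: "rat poly" where p: "fps_of_poly p = ?u * Abs_fps (\<lambda>k. of_nat (2 * k + 1) ^ n)"
    using eulerian_B_aux by blast
  have iff: "fps_of_poly q / ?u = Abs_fps (\<lambda>k. of_nat (2 * k + 1) ^ n) \<longleftrightarrow> q = p" for q
  proof -
    have "fps_of_poly q / ?u * ?u = fps_of_poly q"
      unfolding fps_divide_unit[OF u] mult.assoc inverse_mult_eq_1[OF u] by simp
    then have "fps_of_poly q / ?u = Abs_fps (\<lambda>k. of_nat (2 * k + 1) ^ n) \<longleftrightarrow>
        fps_of_poly q = Abs_fps (\<lambda>k. of_nat (2 * k + 1) ^ n) * ?u"
      using \<open>?u \<noteq> 0\<close> by (metis mult_cancel_right)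
    also have "\<dots> \<longleftrightarrow> q = p"
      using p by (metis mult.commute fps_of_poly_eq_iff)
    finally show ?thesis .
  qed
  show ?thesis
    unfolding eulerian_B_def by (rule theI[of _ p]) (simp_all only: iff)
qed


section \<open>Formal power series in several variables\<close>

text \<open>
  The ring of formal power series in \<open>s\<close> and \<open>t\<close> over the rationals is \<^typ>\<open>rat fps fps\<close>,
  with \<open>t\<close> the outer variable.  Division by a series whose constant term is nonzero is the
  inverse of multiplication; this covers all denominators occurring below.
\<close>

abbreviation var_s :: "rat fps fps" where "var_s \<equiv> fps_const fps_X"
abbreviation var_t :: "rat fps fps" where "var_t \<equiv> fps_X"

lemma fps_fps_divide_times:
  fixes f g :: "rat fps fps"
  assumes "g $ 0 $ 0 \<noteq> 0"
  shows "f / g * g = f"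
proof -
  have "g $ 0 \<noteq> 0" using assms by auto
  then have sub: "subdegree g = 0" by (rule subdegree_eq_0)
  have "g $ 0 * inverse (g $ 0) = 1"
    using assms by (simp add: inverse_mult_eq_1')
  then have "g * inverse g = 1"
    unfolding fps_inverse_def by (rule fps_right_inverse)
  then show ?thesis
    by (simp add: fps_divide_unit'[OF sub] mult.assoc mult.commute)
qed

definition eval_poly2 :: "rat poly \<Rightarrow> rat fps fps \<Rightarrow> rat fps fps" where
  "eval_poly2 p u = poly (map_poly (\<lambda>c. fps_const (fps_const c)) p) u"

text \<open>\<open>gf2 c\<close> is the formal double sum of \<open>c i j * s ^ i * t ^ j\<close> over all \<open>i, j\<close>.\<close>

definition gf2 :: "(nat \<Rightarrow> nat \<Rightarrow> 'a) \<Rightarrow> 'a fps fps" where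
  "gf2 c = Abs_fps (\<lambda>j. Abs_fps (\<lambda>i. c i j))"

text \<open>
  The canonical identification of the power series in \<open>s, t\<close> over \<open>\<rat>[[x]]\<close> with the power series
  in \<open>x\<close> over \<open>\<rat>[[s, t]]\<close>: the coefficient of each monomial is kept.
\<close>

definition x_outermost :: "rat fps fps fps \<Rightarrow> rat fps fps fps" where
  "x_outermost F = Abs_fps (\<lambda>n. gf2 (\<lambda>i j. F $ j $ i $ n))"

end

theory Submission
  imports Defs
begin

text \<open>
  For a fixed permutation \<open>\<pi>\<close> of \<open>{1..n}\<close>, the series \<open>(1 + s)\<^sup>n (4 s / (1 + s)\<^sup>2)\<^bsup>lpk \<pi>\<^esup> / (1 - s)\<^bsup>n+1\<^esup>\<close>
  is the generating function in \<open>i\<close> of the number of left enriched \<open>\<pi>\<close>-partitions with values in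
  \<open>0 < -1 < 1 < \<dots> < -i < i\<close>.  A pair consisting of such a partition for \<open>\<pi>\<close> and one for \<open>\<pi>\<^sup>-\<^sup>1\<close>
  is the same thing, by standardization, as a weakly increasing sequence of length \<open>n\<close> in the set of
  \<open>(2 i + 1) (2 j + 1) = 2 N + 1\<close> pairs of values, ordered suitably, in which a pair may be repeated
  iff its signs agree.  Even and odd ranks alternate between the two kinds of pairs, so these
  sequences are exactly the left enriched partitions of the identity with values up to
  \<open>N = 2 i j + i + j\<close>.  Their number is a Delannoy number, which is symmetric in \<open>n\<close> and \<open>N\<close>, whence
  the expansion \<open>(1 + x)\<^sup>N / (1 - x)\<^bsup>N+1\<^esup>\<close>.  For the last part, removing an element and its image
  from its cycle keeps the parity of the cycle length, so that
  \<open>E\<^sub>n = \<Sum> y\<^bsup>odd cycles\<^esup>\<close> satisfies \<open>E\<^bsub>n+1\<^esub> = y E\<^sub>n + n\<^sup>2 E\<^bsub>n-1\<^esub>\<close>, the recurrence of \<open>n!\<close> times the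
  Delannoy numbers at \<open>y = 2 N + 1\<close>.
\<close>

section \<open>Delannoy numbers\<close>

text \<open>The coefficient of x^m is a Delannoy number: it counts the lattice paths from (0,0) to
  (n,m) with steps (1,0), (0,1) and (1,1).\<close>

definition delannoy :: "nat \<Rightarrow> rat fps" where
  "delannoy n = (1 + fps_X) ^ n / (1 - fps_X) ^ (n + 1)"

lemma fps_divide_eq_iff_mult:
  fixes f g h :: "'a::field fps"
  assumes "g $ 0 \<noteq> 0"
  shows "f / g = h \<longleftrightarrow> f = h * g"
proof -
  have "g \<noteq> 0" using assms by auto
  have "f / g * g = f"
    unfolding fps_divide_unit[OF assms] mult.assoc inverse_mult_eq_1[OF assms] by simp
  then show ?thesis using \<open>g \<noteq> 0\<close> by (metis mult_cancel_right)
qed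

lemma delannoy_eq_iff:
  "F = delannoy n \<longleftrightarrow> (1 - fps_X) ^ (n + 1) * F = (1 + fps_X) ^ n"
proof -
  have "((1 - fps_X) ^ (n + 1) :: rat fps) $ 0 \<noteq> 0" by (simp add: fps_nth_power_0)
  from fps_divide_eq_iff_mult[OF this] show ?thesis
    unfolding delannoy_def by (metis mult.commute)
qed

lemma delannoy_mult: "(1 - fps_X) ^ (n + 1) * delannoy n = (1 + fps_X) ^ n"
  using delannoy_eq_iff by blast

lemma delannoy_rec: "(1 - fps_X) * delannoy (Suc n) = (1 + fps_X) * delannoy n"
proof -
  have "(1 - fps_X) ^ (n + 1) * ((1 - fps_X) * delannoy (Suc n)) =
      (1 + fps_X) * ((1 - fps_X) ^ (n + 1) * delannoy n)"
    unfolding delannoy_mult using delannoy_mult[of "Suc n"] by (simp add: mult_ac)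
  then have "(1 - fps_X) ^ (n + 1) * ((1 - fps_X) * delannoy (Suc n)) =
      (1 - fps_X) ^ (n + 1) * ((1 + fps_X) * delannoy n)"
    by (simp only: mult.left_commute)
  moreover have "((1 - fps_X) ^ (n + 1) :: rat fps) $ 0 \<noteq> 0" by (simp add: fps_nth_power_0)
  then have "(1 - fps_X :: rat fps) ^ (n + 1) \<noteq> 0" by (metis fps_zero_nth)
  ultimately show ?thesis by (metis mult_cancel_left)
qed

lemma delannoy_0_nth: "delannoy 0 $ m = 1"
proof -
  have "Abs_fps (\<lambda>_. 1) = delannoy 0"
    unfolding delannoy_eq_iff by (rule fps_ext) (simp add: algebra_simps)
  then show ?thesis by (metis fps_nth_Abs_fps)
qed

lemma delannoy_nth_0: "delannoy n $ 0 = 1"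
  using arg_cong[OF delannoy_mult[of n], of "\<lambda>f. f $ 0"] by (simp add: fps_nth_power_0)

lemma delannoy_nth_Suc:
  "delannoy (Suc n) $ Suc m = delannoy (Suc n) $ m + delannoy n $ Suc m + delannoy n $ m"
  using arg_cong[OF delannoy_rec[of n], of "\<lambda>f. f $ Suc m"] by (simp add: algebra_simps)

text \<open>Boundary values and recurrence are both invariant under exchanging the indices. The
  exchange links the expansion in x, where N is the exponent, with generating functions over N,
  where n is fixed.\<close>

lemma delannoy_sym: "delannoy n $ m = delannoy m $ n"
proof (induction "n + m" arbitrary: n m rule: less_induct)
  case less
  show ?case
    by (cases n; cases m)
      (simp_all add: delannoy_0_nth delannoy_nth_0 delannoy_nth_Suc less)
qed

text \<open>The Cauchy product of (1 + x)^N and (1 - x)^(-(N + 1)), computed in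
  \<open>delannoy N\<close> and moved to \<open>delannoy n\<close> by symmetry.\<close>

lemma delannoy_nth:
  "delannoy n $ N = (\<Sum>k=0..n. of_nat ((N choose k) * ((N + n - k) choose (n - k))))"
proof -
  have inv: "inverse ((1 - fps_X) ^ (N + 1)) = Abs_fps (\<lambda>k. of_nat ((N + k) choose k) :: rat)"
    using one_minus_const_fps_X_neg_power'[of "N + 1" "1 :: rat"] by simp
  have pow: "((1 + fps_X) ^ N :: rat fps) $ k = of_nat (N choose k)" for k
    by (simp add: fps_binomial_of_nat [symmetric] binomial_gbinomial)
  have "((1 - fps_X) ^ (N + 1) :: rat fps) $ 0 \<noteq> 0" by (simp add: fps_nth_power_0)
  from fps_divide_unit[OF this] have "delannoy N = (1 + fps_X) ^ N * inverse ((1 - fps_X) ^ (N + 1))"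
    unfolding delannoy_def .
  then have "delannoy N $ n = (\<Sum>k=0..n. ((1 + fps_X) ^ N) $ k * inverse ((1 - fps_X) ^ (N + 1)) $ (n - k))"
    by (simp only: fps_mult_nth)
  also have "\<dots> = (\<Sum>k=0..n. of_nat ((N choose k) * ((N + n - k) choose (n - k))))"
    unfolding inv pow by (intro sum.cong) (auto simp: algebra_simps)
  finally show ?thesis by (simp only: delannoy_sym[of n])
qed

text \<open>Logarithmic differentiation:
  \<open>F' / F = N / (1 + x) + (N + 1) / (1 - x) = (2 N + 1 + x) / (1 - x\<^sup>2)\<close> for \<open>F = delannoy N\<close>.\<close>

lemma delannoy_ode:
  "(1 - fps_X ^ 2) * fps_deriv (delannoy N) = (of_nat (2 * N + 1) + fps_X) * delannoy N"
proof -
  let ?X = "fps_X :: rat fps" and ?F = "delannoy N"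
  have dm: "fps_deriv ((1 - ?X) ^ (N + 1)) = - (of_nat (N + 1) * (1 - ?X) ^ N)"
    by (subst fps_deriv_power) (simp add: fps_of_nat [symmetric] flip: smult_minus_left)
  \<comment> \<open>The factor 1 + x restores the exponent N, which avoids N - 1 in the
    statement.\<close>
  have dp: "(1 + ?X) * fps_deriv ((1 + ?X) ^ N) = of_nat N * (1 + ?X) ^ N"
    by (subst fps_deriv_power) (cases N; simp add: fps_of_nat [symmetric] algebra_simps)
  have "fps_deriv ((1 - ?X) ^ (N + 1) * ?F) = fps_deriv ((1 + ?X) ^ N)"
    by (simp only: delannoy_mult)
  then have "(1 + ?X) * ((1 - ?X) ^ (N + 1) * fps_deriv ?F - of_nat (N + 1) * (1 - ?X) ^ N * ?F) =
      of_nat N * (1 + ?X) ^ N"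
    unfolding fps_deriv_mult dm using dp by simp
  also have "\<dots> = of_nat N * ((1 - ?X) ^ (N + 1) * ?F)"
    by (simp only: delannoy_mult)
  finally have "(1 - ?X) ^ N * ((1 - ?X ^ 2) * fps_deriv ?F) =
      (1 - ?X) ^ N * ((of_nat (2 * N + 1) + ?X) * ?F)"
    by (simp add: algebra_simps power2_eq_square)
  moreover have "((1 - fps_X) ^ N :: rat fps) $ 0 \<noteq> 0" by (simp add: fps_nth_power_0)
  then have "(1 - fps_X :: rat fps) ^ N \<noteq> 0" by (metis fps_zero_nth)
  ultimately show ?thesis by (metis mult_cancel_left)
qed

lemma delannoy_nth_1: "delannoy N $ 1 = of_nat (2 * N + 1)"
  using arg_cong[OF delannoy_ode[of N], of "\<lambda>f. f $ 0"]
  by (simp add: delannoy_nth_0 fps_of_nat [symmetric] fps_nth_power_0)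

text \<open>Compares the coefficients of x^(n + 1) in the differential equation. Multiplied by
  \<open>fact (n + 1)\<close>, this becomes the recurrence for permutations by odd cycles.\<close>

lemma delannoy_three_term:
  "of_nat (n + 2) * delannoy N $ (n + 2) =
     of_nat (2 * N + 1) * delannoy N $ (n + 1) + of_nat (n + 1) * delannoy N $ n"
proof -
  have "fps_deriv (delannoy N) = fps_X ^ 2 * fps_deriv (delannoy N)
      + fps_const (of_nat (2 * N + 1)) * delannoy N + fps_X * delannoy N"
    using delannoy_ode[of N] unfolding fps_of_nat by (simp add: algebra_simps del: of_nat_add of_nat_mult)
  from arg_cong[OF this, of "\<lambda>f. f $ (n + 1)"] show ?thesis
    by (cases n) (simp_all add: power2_eq_square mult.assoc algebra_simps)
qed

section \<open>Left enriched partitions\<close>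

text \<open>The values \<open>0 < -1 < 1 < -2 < 2 < \<dots>\<close> are encoded as \<open>0, 1, 2, 3, 4, \<dots>\<close>, so the negative values
  are the odd numbers and the bound \<open>i\<close> becomes \<open>2 * i\<close>.\<close>

definition step_ok :: "bool \<Rightarrow> nat \<Rightarrow> nat \<Rightarrow> bool" where
  "step_ok asc a b \<longleftrightarrow> a < b \<or> a = b \<and> (even a \<longleftrightarrow> asc)"

text \<open>Values are listed along \<pi>, so conditions on neighbours suffice: a repeated value
  must be nonnegative at an ascent and negative at a descent.\<close>

definition lepp :: "nat \<Rightarrow> (nat \<Rightarrow> nat) \<Rightarrow> nat \<Rightarrow> (nat \<Rightarrow> nat) set" where
  "lepp n \<pi> M = {f \<in> {1..n} \<rightarrow>\<^sub>E {..M}. \<forall>k\<in>{1..<n}. step_ok (\<pi> k < \<pi> (k + 1)) (f k) (f (k + 1))}"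

lemma finite_lepp [simp]: "finite (lepp n \<pi> M)"
  unfolding lepp_def by (rule finite_subset[of _ "{1..n} \<rightarrow>\<^sub>E {..M}"]) (auto intro!: finite_PiE)

lemma lepp_le_last:
  assumes "f \<in> lepp n \<pi> M" "k \<in> {1..n}"
  shows "f k \<le> f n"
proof -
  have "k \<le> n" using assms by simp
  then show ?thesis
  proof (induction rule: inc_induct)
    case (step j)
    have "f j \<le> f (Suc j)"
      using assms step unfolding lepp_def step_ok_def by force
    with step show ?case by simp
  qed simp
qed

lemma lepp_last_le: "f \<in> lepp n \<pi> M \<Longrightarrow> n \<ge> 1 \<Longrightarrow> f n \<le> M"
  unfolding lepp_def by (auto simp: PiE_iff)

text \<open>Members are weakly increasing, so a bound on the last value bounds them all.\<close>

lemma lepp_bounded_last: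
  assumes "n \<ge> 1" "M \<le> M'"
  shows "lepp n \<pi> M = {f \<in> lepp n \<pi> M'. f n \<le> M}"
proof (intro set_eqI iffI)
  fix f assume f: "f \<in> lepp n \<pi> M"
  then have "f \<in> {1..n} \<rightarrow>\<^sub>E {..M'}"
    using assms unfolding lepp_def by (auto simp: PiE_iff intro: order_trans)
  with f show "f \<in> {f \<in> lepp n \<pi> M'. f n \<le> M}"
    using lepp_last_le[OF f assms(1)] unfolding lepp_def by auto
next
  fix f assume f: "f \<in> {f \<in> lepp n \<pi> M'. f n \<le> M}"
  then have "f k \<le> M" if "k \<in> {1..n}" for k
    using lepp_le_last[of f n \<pi> M' k] that by auto
  with f show "f \<in> lepp n \<pi> M" unfolding lepp_def by (auto simp: PiE_iff)
qed

lemma card_lepp_last: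
  assumes "n \<ge> 1"
  shows "card {f \<in> lepp (Suc n) \<pi> M. f (Suc n) = M} =
    card {g \<in> lepp n \<pi> M. step_ok (\<pi> n < \<pi> (n + 1)) (g n) M}"
proof -
  have "bij_betw (\<lambda>g. g(Suc n := M)) {g \<in> lepp n \<pi> M. step_ok (\<pi> n < \<pi> (n + 1)) (g n) M}
      {f \<in> lepp (Suc n) \<pi> M. f (Suc n) = M}"
  \<comment> \<open>Extensional functions are \<open>undefined\<close> outside their domain, so
    deleting the last value means resetting it to \<open>undefined\<close>.\<close>
  proof (rule bij_betw_byWitness[where f' = "\<lambda>f. f(Suc n := undefined)"], goal_cases)
    case 1
    show ?case by (auto simp: lepp_def PiE_iff extensional_def fun_eq_iff)
  next
    case 2
    show ?case by auto
  next
    case 3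
    show ?case
    proof (rule image_subsetI)
      fix g assume g: "g \<in> {g \<in> lepp n \<pi> M. step_ok (\<pi> n < \<pi> (n + 1)) (g n) M}"
      have "step_ok (\<pi> k < \<pi> (k + 1)) ((g(Suc n := M)) k) ((g(Suc n := M)) (k + 1))"
        if "k \<in> {1..<Suc n}" for k
        using g that by (cases "k = n") (auto simp: lepp_def)
      moreover have "g(Suc n := M) \<in> {1..Suc n} \<rightarrow>\<^sub>E {..M}"
        using g by (auto simp: lepp_def PiE_iff extensional_def)
      ultimately show "g(Suc n := M) \<in> {f \<in> lepp (Suc n) \<pi> M. f (Suc n) = M}"
        by (simp add: lepp_def)
    qed
  next
    case 4
    show ?case
    proof (rule image_subsetI)
      fix f assume f: "f \<in> {f \<in> lepp (Suc n) \<pi> M. f (Suc n) = M}"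
      then have "f(Suc n := undefined) \<in> {1..n} \<rightarrow>\<^sub>E {..M}"
        by (auto simp: lepp_def PiE_iff extensional_def)
      moreover have "step_ok (\<pi> n < \<pi> (n + 1)) (f n) M"
        using f assms by (auto simp: lepp_def)
      ultimately show "f(Suc n := undefined) \<in> {g \<in> lepp n \<pi> M. step_ok (\<pi> n < \<pi> (n + 1)) (g n) M}"
        using f by (auto simp: lepp_def)
    qed
  qed
  from bij_betw_same_card[OF this] show ?thesis by simp
qed

lemma card_lepp_Suc_0:
  assumes "n \<ge> 1"
  shows "card (lepp (Suc n) \<pi> 0) = (if \<pi> n < \<pi> (n + 1) then card (lepp n \<pi> 0) else 0)"
proof -
  have "lepp (Suc n) \<pi> 0 = {f \<in> lepp (Suc n) \<pi> 0. f (Suc n) = 0}"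
    by (auto simp: lepp_def PiE_iff)
  moreover have "{g \<in> lepp n \<pi> 0. step_ok (\<pi> n < \<pi> (n + 1)) (g n) 0} =
      (if \<pi> n < \<pi> (n + 1) then lepp n \<pi> 0 else {})"
    using assms by (auto simp: lepp_def step_ok_def PiE_iff)
  ultimately show ?thesis using card_lepp_last[OF assms, of \<pi> 0] by (simp split: if_splits)
qed

text \<open>Members not bounded by \<open>M\<close> end in \<open>Suc M\<close>. Deleting that entry
  leaves a sequence that may itself end in \<open>Suc M\<close> exactly when this value may be
  repeated at step \<open>n\<close>.\<close>

lemma card_lepp_Suc_Suc:
  assumes "n \<ge> 1"
  shows "card (lepp (Suc n) \<pi> (Suc M)) = card (lepp (Suc n) \<pi> M) +
    card (lepp n \<pi> (if even (Suc M) \<longleftrightarrow> \<pi> n < \<pi> (n + 1) then Suc M else M))"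
proof -
  have last: "f (Suc n) \<le> M \<or> f (Suc n) = Suc M" if "f \<in> lepp (Suc n) \<pi> (Suc M)" for f
    using lepp_last_le[OF that] by auto
  have last': "f n \<le> M \<or> f n = Suc M" if "f \<in> lepp n \<pi> (Suc M)" for f
    using lepp_last_le[OF that assms] by auto
  have bounded: "f \<in> lepp n \<pi> M \<longleftrightarrow> f \<in> lepp n \<pi> (Suc M) \<and> f n \<le> M" for f
    using lepp_bounded_last[OF assms, of M "Suc M" \<pi>] by auto
  have "lepp (Suc n) \<pi> (Suc M) = lepp (Suc n) \<pi> M \<union> {f \<in> lepp (Suc n) \<pi> (Suc M). f (Suc n) = Suc M}"
    unfolding lepp_bounded_last[of "Suc n" M "Suc M" \<pi>, simplified]
    by (auto dest: last)
  moreover have "lepp (Suc n) \<pi> M \<inter> {f \<in> lepp (Suc n) \<pi> (Suc M). f (Suc n) = Suc M} = {}"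
    using lepp_last_le[of _ "Suc n" \<pi> M] by fastforce
  ultimately have "card (lepp (Suc n) \<pi> (Suc M)) =
      card (lepp (Suc n) \<pi> M) + card {f \<in> lepp (Suc n) \<pi> (Suc M). f (Suc n) = Suc M}"
    by (metis (no_types, lifting) card_Un_disjoint finite_Un finite_lepp)
  moreover have "{g \<in> lepp n \<pi> (Suc M). step_ok (\<pi> n < \<pi> (n + 1)) (g n) (Suc M)} =
      lepp n \<pi> (if even (Suc M) \<longleftrightarrow> \<pi> n < \<pi> (n + 1) then Suc M else M)"
    by (auto dest: last' simp: step_ok_def le_Suc_eq less_Suc_eq_le bounded)
  ultimately show ?thesis using card_lepp_last[OF assms, of \<pi> "Suc M"] by simp
qed

lemma card_lepp_1: "card (lepp 1 \<pi> M) = M + 1"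
proof -
  have "lepp 1 \<pi> M = {1} \<rightarrow>\<^sub>E {..M}" unfolding lepp_def by auto
  then show ?thesis by (simp add: card_PiE)
qed

section \<open>Left peaks and generating functions of left enriched partitions\<close>

lemma left_peak_imp: "left_peak n \<pi> i \<Longrightarrow> i \<ge> 1 \<and> i < n"
  unfolding left_peak_def by auto

lemma finite_left_peaks [simp]: "finite {i. left_peak n \<pi> i}"
  by (rule finite_subset[of _ "{..n}"]) (auto dest: left_peak_imp)

lemma lpk_1: "lpk 1 \<pi> = 0"
proof -
  have "{i. left_peak 1 \<pi> i} = {}" by (auto dest: left_peak_imp)
  then show ?thesis unfolding lpk_def by simp
qed

text \<open>Only position \<open>n\<close> is affected, since it gains a right neighbour. The case
  \<open>n = 1\<close> is the convention at the left end.\<close>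

lemma lpk_Suc:
  assumes "n \<ge> 1"
  shows "lpk (Suc n) \<pi> =
    lpk n \<pi> + (if \<pi> (n + 1) < \<pi> n \<and> (n = 1 \<or> \<pi> (n - 1) < \<pi> n) then 1 else 0)"
proof -
  have old: "left_peak (Suc n) \<pi> i \<longleftrightarrow> left_peak n \<pi> i" if "i \<noteq> n" for i
    using that unfolding left_peak_def peak_def by auto
  have no: "\<not> left_peak n \<pi> n"
    by (auto dest: left_peak_imp)
  have new: "left_peak (Suc n) \<pi> n \<longleftrightarrow> \<pi> (n + 1) < \<pi> n \<and> (n = 1 \<or> \<pi> (n - 1) < \<pi> n)"
    using assms unfolding left_peak_def peak_def by (cases "n = 1") (auto simp: numeral_2_eq_2)
  show ?thesis
  proof (cases "left_peak (Suc n) \<pi> n")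
    case True
    then have "{i. left_peak (Suc n) \<pi> i} = insert n {i. left_peak n \<pi> i}"
      by (intro set_eqI, case_tac "x = n") (simp_all add: old)
    then show ?thesis using True no new unfolding lpk_def by simp
  next
    case False
    then have "{i. left_peak (Suc n) \<pi> i} = {i. left_peak n \<pi> i}"
      by (intro set_eqI, case_tac "x = n") (simp_all add: old no)
    then show ?thesis using False new unfolding lpk_def by simp
  qed
qed

lemma lpk_id: "lpk n id = 0"
proof -
  have "{i. left_peak n id i} = {}" by (auto simp: left_peak_def peak_def)
  then show ?thesis unfolding lpk_def by (metis card.empty)
qed

definition lepp_gf :: "nat \<Rightarrow> (nat \<Rightarrow> nat) \<Rightarrow> rat fps" where
  "lepp_gf n \<pi> = Abs_fps (\<lambda>i. of_nat (card (lepp n \<pi> (2 * i))))"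

text \<open>The bound \<open>2 * i + 1\<close> admits -(i + 1) but not i + 1. The recurrence in the
  bound alternates between the two parities, so both series are needed.\<close>

definition lepp_gf_odd :: "nat \<Rightarrow> (nat \<Rightarrow> nat) \<Rightarrow> rat fps" where
  "lepp_gf_odd n \<pi> = Abs_fps (\<lambda>i. of_nat (card (lepp n \<pi> (2 * i + 1))))"

lemma lepp_gf_Suc:
  assumes "n \<ge> 1"
  shows "lepp_gf (Suc n) \<pi> = fps_X * lepp_gf_odd (Suc n) \<pi> +
    (if \<pi> n < \<pi> (n + 1) then lepp_gf n \<pi> else fps_X * lepp_gf_odd n \<pi>)"
proof (rule fps_ext)
  fix i
  show "lepp_gf (Suc n) \<pi> $ i = (fps_X * lepp_gf_odd (Suc n) \<pi> +
    (if \<pi> n < \<pi> (n + 1) then lepp_gf n \<pi> else fps_X * lepp_gf_odd n \<pi>)) $ i"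
    \<comment> \<open>For positive \<open>i\<close> the second instance goes from the bound 2i - 1
      to 2i; \<open>i = 0\<close> is the bound 0.\<close>
    using card_lepp_Suc_0[OF assms, of \<pi>] card_lepp_Suc_Suc[OF assms, of \<pi> "2 * (i - 1) + 1"]
    by (cases i) (auto simp: lepp_gf_def lepp_gf_odd_def)
qed

lemma lepp_gf_odd_Suc:
  assumes "n \<ge> 1"
  shows "lepp_gf_odd (Suc n) \<pi> = lepp_gf (Suc n) \<pi> +
    (if \<pi> n < \<pi> (n + 1) then lepp_gf n \<pi> else lepp_gf_odd n \<pi>)"
proof (rule fps_ext)
  fix i
  show "lepp_gf_odd (Suc n) \<pi> $ i = (lepp_gf (Suc n) \<pi> +
    (if \<pi> n < \<pi> (n + 1) then lepp_gf n \<pi> else lepp_gf_odd n \<pi>)) $ i"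
    using card_lepp_Suc_Suc[OF assms, of \<pi> "2 * i"]
    by (auto simp: lepp_gf_def lepp_gf_odd_def)
qed

lemma lepp_gf_1: "(1 - fps_X) ^ 2 * lepp_gf 1 \<pi> = 1 + fps_X"
proof -
  have "(1 - fps_X) * lepp_gf 1 \<pi> = Abs_fps (\<lambda>i. if i = 0 then 1 else 2)"
    by (rule fps_ext) (simp add: lepp_gf_def card_lepp_1[simplified] algebra_simps)
  moreover have "(1 - fps_X) * Abs_fps (\<lambda>i. if i = 0 then 1 else 2 :: rat) = 1 + fps_X"
    by (rule fps_ext) (auto simp: algebra_simps fps_X_nth)
  ultimately show ?thesis by (simp add: power2_eq_square mult.assoc)
qed

lemma lepp_gf_odd_1: "(1 + fps_X) * lepp_gf_odd 1 \<pi> = 2 * lepp_gf 1 \<pi>"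
  by (rule fps_ext) (simp add: lepp_gf_def lepp_gf_odd_def card_lepp_1[simplified] numeral_fps_const algebra_simps)

text \<open>Each new position multiplies the series by (1 + x)/(1 - x), and a new left peak
  contributes a further 4x/(1 + x)^2. To continue the induction one must know the ratio of the odd
  series to the even one; it depends only on whether the last step was an ascent or a descent, and
  \<open>n = 1\<close> counts as an ascent. Denominators are cleared throughout.\<close>

lemma lepp_gf_invariant:
  assumes "n \<ge> 1" "inj \<pi>"
  shows "(1 - fps_X) ^ (n + 1) * (1 + fps_X) ^ (2 * lpk n \<pi>) * lepp_gf n \<pi> =
      (1 + fps_X) ^ n * (4 * fps_X) ^ lpk n \<pi> \<and>
    (if n = 1 \<or> \<pi> (n - 1) < \<pi> n
     then (1 + fps_X) * lepp_gf_odd n \<pi> = 2 * lepp_gf n \<pi>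
     else 2 * fps_X * lepp_gf_odd n \<pi> = (1 + fps_X) * lepp_gf n \<pi>)"
  using assms(1)
proof (induction n rule: dec_induct)
  case base
  show ?case using lepp_gf_1 lepp_gf_odd_1 lpk_1 by (simp add: numeral_2_eq_2)
next
  case (step n)
  let ?X = "fps_X :: rat fps"
  let ?l = "lpk n \<pi>"
  define U V U' V' where UV: "U = lepp_gf n \<pi>" "V = lepp_gf_odd n \<pi>"
    "U' = lepp_gf (Suc n) \<pi>" "V' = lepp_gf_odd (Suc n) \<pi>"
  have IH: "(1 - ?X) ^ (n + 1) * (1 + ?X) ^ (2 * ?l) * U = (1 + ?X) ^ n * (4 * ?X) ^ ?l"
    using step unfolding UV by blast
  have ne: "\<pi> n \<noteq> \<pi> (n + 1)" using \<open>inj \<pi>\<close> by (metis injD less_add_one nat_neq_iff)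
  note U' = lepp_gf_Suc[OF \<open>1 \<le> n\<close>, of \<pi>, folded UV]
  note V' = lepp_gf_odd_Suc[OF \<open>1 \<le> n\<close>, of \<pi>, folded UV]
  \<comment> \<open>Shared by an ascent and a descent following a descent, neither of which creates
    a left peak.\<close>
  have asc_desc: "(1 - ?X) ^ (Suc n + 1) * (1 + ?X) ^ (2 * ?l) * U' = (1 + ?X) ^ Suc n * (4 * ?X) ^ ?l"
    if *: "(1 - ?X) * U' = (1 + ?X) * U"
  proof -
    have "(1 - ?X) ^ (Suc n + 1) * (1 + ?X) ^ (2 * ?l) * U' =
        (1 - ?X) ^ (n + 1) * (1 + ?X) ^ (2 * ?l) * ((1 - ?X) * U')" by (simp add: mult_ac)
    also have "\<dots> = (1 + ?X) * ((1 - ?X) ^ (n + 1) * (1 + ?X) ^ (2 * ?l) * U)"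
      unfolding * by (simp only: mult_ac)
    finally show ?thesis unfolding IH by (simp add: mult_ac)
  qed
  consider (asc) "\<pi> n < \<pi> (n + 1)"
    | (peak) "\<pi> (n + 1) < \<pi> n" "n = 1 \<or> \<pi> (n - 1) < \<pi> n"
    | (ddesc) "\<pi> (n + 1) < \<pi> n" "\<not> (n = 1 \<or> \<pi> (n - 1) < \<pi> n)"
    using ne by linarith
  then show ?case
  proof cases
    case asc
    then have "(1 - ?X) * U' = (1 + ?X) * U" "(1 + ?X) * V' = 2 * U'"
      using U' V' by (simp_all, algebra+)
    then show ?thesis using asc asc_desc lpk_Suc[OF \<open>1 \<le> n\<close>, of \<pi>] unfolding UV by simp
  next
    case peak
    have V: "(1 + ?X) * V = 2 * U" using step peak unfolding UV by simp
    have UV': "U' = ?X * V' + ?X * V" "V' = U' + V" using U' V' peak by simp_all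
    then have *: "(1 + ?X) * ((1 - ?X) * U') = 4 * ?X * U" using V by algebra
    have "(1 - ?X) ^ (Suc n + 1) * (1 + ?X) ^ (2 * Suc ?l) * U' =
        (1 - ?X) ^ (n + 1) * (1 + ?X) ^ (2 * ?l) * ((1 + ?X) * ((1 + ?X) * ((1 - ?X) * U')))"
      by (simp add: mult_ac)
    also have "\<dots> = (1 + ?X) * (4 * ?X) * ((1 - ?X) ^ (n + 1) * (1 + ?X) ^ (2 * ?l) * U)"
      unfolding * by (simp only: mult_ac)
    finally have "(1 - ?X) ^ (Suc n + 1) * (1 + ?X) ^ (2 * Suc ?l) * U' =
        (1 + ?X) ^ Suc n * (4 * ?X) ^ Suc ?l" unfolding IH by (simp add: mult_ac)
    moreover have "2 * ?X * V' = (1 + ?X) * U'" using UV' by algebra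
    ultimately show ?thesis
      using peak lpk_Suc[OF \<open>1 \<le> n\<close>, of \<pi>] \<open>1 \<le> n\<close> unfolding UV by simp
  next
    case ddesc
    have V: "2 * ?X * V = (1 + ?X) * U" using step ddesc unfolding UV by simp
    have UV': "U' = ?X * V' + ?X * V" "V' = U' + V" using U' V' ddesc by simp_all
    have "(1 - ?X) * U' = (1 + ?X) * U" "2 * ?X * V' = (1 + ?X) * U'"
      using UV' V by algebra+
    then show ?thesis
      using ddesc asc_desc lpk_Suc[OF \<open>1 \<le> n\<close>, of \<pi>] \<open>1 \<le> n\<close> unfolding UV by simp
  qed
qed

lemma lepp_gf_eq:
  assumes "n \<ge> 1" "inj \<pi>"
  shows "(1 - fps_X) ^ (n + 1) * (1 + fps_X) ^ (2 * lpk n \<pi>) * lepp_gf n \<pi> =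
      (1 + fps_X) ^ n * (4 * fps_X) ^ lpk n \<pi>"
  using lepp_gf_invariant[OF assms] by blast

section \<open>Standardization\<close>

text \<open>Existence comes from sorting the keys. For uniqueness, the keys read along any such
  permutation form the sorted list, and injectivity recovers the positions.\<close>

lemma ex1_sorting_permutation:
  fixes key :: "nat \<Rightarrow> nat"
  assumes inj: "inj_on key {1..n}"
  shows "\<exists>!\<sigma>. \<sigma> permutes {1..n} \<and> (\<forall>m\<in>{1..<n}. key (\<sigma> m) < key (\<sigma> (m + 1)))"
proof (rule ex_ex1I)
  define L where "L = sorted_list_of_set (key ` {1..n})"
  have len: "length L = n" and set: "set L = key ` {1..n}" and sorted: "sorted_wrt (<) L"
    unfolding L_def using card_image[OF inj] by simp_all
  have dist: "distinct L" unfolding L_def by simp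
  \<comment> \<open>The position carrying the m-th smallest key; list indices start at 0.\<close>
  define \<sigma> where "\<sigma> m = (if m \<in> {1..n} then the_inv_into {1..n} key (L ! (m - 1)) else m)" for m
  have mem: "L ! (m - 1) \<in> key ` {1..n}" if "m \<in> {1..n}" for m
    unfolding set[symmetric] using that len by (intro nth_mem) auto
  have key_\<sigma>: "key (\<sigma> m) = L ! (m - 1)" if "m \<in> {1..n}" for m
    using f_the_inv_into_f[OF inj mem[OF that]] that unfolding \<sigma>_def by simp
  have "bij_betw \<sigma> {1..n} {1..n}"
  proof -
    have "inj_on \<sigma> {1..n}"
    proof (rule inj_onI)
      fix m m' assume m: "m \<in> {1..n}" "m' \<in> {1..n}" "\<sigma> m = \<sigma> m'"
      then have "L ! (m - 1) = L ! (m' - 1)" using key_\<sigma> by metis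
      then have "m - 1 = m' - 1" using dist m len by (subst (asm) nth_eq_iff_index_eq) auto
      then show "m = m'" using m by auto
    qed
    moreover have "\<sigma> ` {1..n} \<subseteq> {1..n}"
      using the_inv_into_into[OF inj mem subset_refl] unfolding \<sigma>_def by (simp add: image_subset_iff)
    ultimately show ?thesis
      by (simp add: bij_betw_def card_image card_subset_eq)
  qed
  then have "\<sigma> permutes {1..n}" by (rule bij_imp_permutes) (auto simp: \<sigma>_def)
  moreover have "key (\<sigma> m) < key (\<sigma> (m + 1))" if "m \<in> {1..<n}" for m
    using that key_\<sigma>[of m] key_\<sigma>[of "m + 1"] sorted_wrt_nth_less[OF sorted, of "m - 1" m] len
    by auto
  ultimately show "\<exists>\<sigma>. \<sigma> permutes {1..n} \<and> (\<forall>m\<in>{1..<n}. key (\<sigma> m) < key (\<sigma> (m + 1)))"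
    by blast
next
  have uniq: "map (key \<circ> \<sigma>) [1..<n + 1] = sorted_list_of_set (key ` {1..n})"
    if "\<sigma> permutes {1..n}" "\<forall>m\<in>{1..<n}. key (\<sigma> m) < key (\<sigma> (m + 1))" for \<sigma>
  proof -
    have "sorted_wrt (<) (map (key \<circ> \<sigma>) [1..<n + 1])"
      using that(2) by (auto simp: sorted_wrt_iff_nth_Suc_transp simp del: upt_Suc)
    moreover have "set (map (key \<circ> \<sigma>) [1..<n + 1]) = key ` {1..n}"
      by (simp only: set_map set_upt Suc_eq_plus1[symmetric] atLeastLessThanSuc_atLeastAtMost
          image_comp[symmetric] permutes_image[OF that(1)])
    ultimately show ?thesis by (metis sorted_list_of_set.idem_if_sorted_distinct strict_sorted_iff)
  qed
  fix \<sigma> \<tau>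
  assume \<sigma>: "\<sigma> permutes {1..n} \<and> (\<forall>m\<in>{1..<n}. key (\<sigma> m) < key (\<sigma> (m + 1)))"
    and \<tau>: "\<tau> permutes {1..n} \<and> (\<forall>m\<in>{1..<n}. key (\<tau> m) < key (\<tau> (m + 1)))"
  have "map (key \<circ> \<sigma>) [1..<n + 1] = map (key \<circ> \<tau>) [1..<n + 1]"
    using uniq \<sigma> \<tau> by metis
  then have eq: "key (\<sigma> m) = key (\<tau> m)" if "m \<in> {1..n}" for m
    using that by (auto simp: map_eq_conv simp del: upt_Suc)
  show "\<sigma> = \<tau>"
  proof
    fix m
    show "\<sigma> m = \<tau> m"
    proof (cases "m \<in> {1..n}")
      case True
      then have "\<sigma> m \<in> {1..n}" "\<tau> m \<in> {1..n}"
        by (simp_all only: permutes_in_image[OF conjunct1[OF \<sigma>]] permutes_in_image[OF conjunct1[OF \<tau>]])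
      then show ?thesis using inj_onD[OF inj eq[OF True]] by simp
    next
      case False
      then show ?thesis
        by (simp only: permutes_not_in[OF conjunct1[OF \<sigma>]] permutes_not_in[OF conjunct1[OF \<tau>]] not_False_eq_True)
    qed
  qed
qed

text \<open>Positions are sorted by their letter, equal letters from left to right when even (nonnegative) and
  from right to left when odd (negative).\<close>

definition std_key :: "nat \<Rightarrow> (nat \<Rightarrow> nat) \<Rightarrow> nat \<Rightarrow> nat" where
  "std_key n b k = b k * (n + 1) + (if even (b k) then k else n - k)"

text \<open>Numbers with remainders below \<open>m\<close> compare lexicographically by quotient and
  remainder. Both \<open>std_key\<close> and \<open>enc\<close> rest on this.\<close>

lemma block_less_iff:
  fixes a b r s m :: nat
  assumes "r < m" "s < m"
  shows "a * m + r < b * m + s \<longleftrightarrow> a < b \<or> a = b \<and> r < s"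
proof (cases a b rule: linorder_cases)
  case less
  then have "Suc a * m \<le> b * m" by (simp only: mult_le_mono1 Suc_leI)
  then show ?thesis using less assms by simp
next
  case greater
  then have "Suc b * m \<le> a * m" by (simp only: mult_le_mono1 Suc_leI)
  then show ?thesis using greater assms by simp
qed simp

lemma std_key_less_iff:
  assumes "k \<in> {1..n}" "l \<in> {1..n}"
  shows "std_key n b k < std_key n b l \<longleftrightarrow>
    b k < b l \<or> b k = b l \<and> (if even (b k) then k < l else l < k)"
proof -
  have "(if even (b k) then k else n - k) < n + 1" "(if even (b l) then l else n - l) < n + 1"
    using assms by auto
  from block_less_iff[OF this, of "b k" "b l"] show ?thesis
    unfolding std_key_def using assms by auto
qed

lemma inj_on_std_key: "inj_on (std_key n b) {1..n}"
proof (rule inj_onI)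
  fix k l assume kl: "k \<in> {1..n}" "l \<in> {1..n}" "std_key n b k = std_key n b l"
  then show "k = l"
    using std_key_less_iff[OF kl(1,2), of b] std_key_less_iff[OF kl(2,1), of b]
    by (cases "b k" "b l" rule: linorder_cases; cases k l rule: linorder_cases) (auto split: if_splits)
qed

text \<open>Equal neighbours must be even at an ascent of \<open>inv \<pi>\<close> and odd at a
  descent, which is exactly the tie-breaking rule of \<open>std_key\<close>.\<close>

lemma lepp_inv_iff_std_key:
  assumes \<pi>: "\<pi> permutes {1..n}" and b: "b \<in> {1..n} \<rightarrow> {..M}"
  shows "(\<lambda>m\<in>{1..n}. b (inv \<pi> m)) \<in> lepp n (inv \<pi>) M \<longleftrightarrow>
    (\<forall>m\<in>{1..<n}. std_key n b (inv \<pi> m) < std_key n b (inv \<pi> (m + 1)))"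
proof -
  have mem: "inv \<pi> m \<in> {1..n}" if "m \<in> {1..n}" for m
    using permutes_in_image[OF permutes_inv[OF \<pi>]] that by blast
  have "step_ok (inv \<pi> m < inv \<pi> (m + 1)) (b (inv \<pi> m)) (b (inv \<pi> (m + 1))) \<longleftrightarrow>
      std_key n b (inv \<pi> m) < std_key n b (inv \<pi> (m + 1))" if "m \<in> {1..<n}" for m
  proof -
    have "inv \<pi> m \<noteq> inv \<pi> (m + 1)"
      using permutes_inj[OF permutes_inv[OF \<pi>]] by (metis injD less_add_one nat_neq_iff)
    moreover have "m \<in> {1..n}" "m + 1 \<in> {1..n}" using that by auto
    ultimately show ?thesis
      using std_key_less_iff[OF mem mem, of m "m + 1" b] unfolding step_ok_def by auto
  qed
  moreover have "(\<lambda>m\<in>{1..n}. b (inv \<pi> m)) \<in> {1..n} \<rightarrow>\<^sub>E {..M}"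
    using b mem by auto
  ultimately show ?thesis unfolding lepp_def by auto
qed

text \<open>The inverse of the permutation that sorts the positions by \<open>std_key\<close> is the
  standardization of the word \<open>b\<close>.\<close>

lemma ex1_standardization:
  assumes b: "b \<in> {1..n} \<rightarrow> {..M}"
  shows "\<exists>!\<pi>. \<pi> permutes {1..n} \<and> (\<lambda>m\<in>{1..n}. b (inv \<pi> m)) \<in> lepp n (inv \<pi>) M"
proof -
  obtain \<sigma> where \<sigma>: "\<sigma> permutes {1..n}"
      "\<forall>m\<in>{1..<n}. std_key n b (\<sigma> m) < std_key n b (\<sigma> (m + 1))"
    and uniq: "\<And>\<tau>. \<tau> permutes {1..n} \<Longrightarrow>
      \<forall>m\<in>{1..<n}. std_key n b (\<tau> m) < std_key n b (\<tau> (m + 1)) \<Longrightarrow> \<tau> = \<sigma>"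
    using ex1_sorting_permutation[OF inj_on_std_key[of n b]] by blast
  show ?thesis
  proof (rule ex1I[of _ "inv \<sigma>"])
    show "inv \<sigma> permutes {1..n} \<and> (\<lambda>m\<in>{1..n}. b (inv (inv \<sigma>) m)) \<in> lepp n (inv (inv \<sigma>)) M"
      using \<sigma> lepp_inv_iff_std_key[OF permutes_inv[OF \<sigma>(1)] b] permutes_inv[OF \<sigma>(1)]
      by (simp add: permutes_inv_inv[OF \<sigma>(1)])
  next
    fix \<pi> assume \<pi>: "\<pi> permutes {1..n} \<and> (\<lambda>m\<in>{1..n}. b (inv \<pi> m)) \<in> lepp n (inv \<pi>) M"
    then have "inv \<pi> = \<sigma>" using lepp_inv_iff_std_key[OF _ b, of \<pi>] uniq permutes_inv by blast
    then show "\<pi> = inv \<sigma>" using \<pi> permutes_inv_inv by metis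
  qed
qed

text \<open>\<open>\<pi> k\<close> is the rank of position \<open>k\<close> in key order. Chaining
  the comparisons of consecutive ranks gives one direction, and exchanging \<open>k\<close> and
  \<open>l\<close> gives the other.\<close>

lemma standardization_less_iff:
  assumes \<pi>: "\<pi> permutes {1..n}" and b: "b \<in> {1..n} \<rightarrow> {..M}"
    and std: "(\<lambda>m\<in>{1..n}. b (inv \<pi> m)) \<in> lepp n (inv \<pi>) M"
    and kl: "k \<in> {1..n}" "l \<in> {1..n}"
  shows "\<pi> k < \<pi> l \<longleftrightarrow> std_key n b k < std_key n b l"
proof -
  have key: "std_key n b (inv \<pi> m) < std_key n b (inv \<pi> (m + 1))" if "m \<in> {1..<n}" for m
    using lepp_inv_iff_std_key[OF \<pi> b] std that by blast
  have mono: "std_key n b (inv \<pi> m) < std_key n b (inv \<pi> m')"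
    if "m \<ge> 1" "m + 1 \<le> m'" "m' \<le> n" for m m'
    using that(2,3)
  proof (induction rule: dec_induct)
    case base
    then show ?case using key that(1) by simp
  next
    case (step i)
    then have "std_key n b (inv \<pi> i) < std_key n b (inv \<pi> (i + 1))"
      using key that(1) by (metis Suc_eq_plus1 atLeastLessThan_iff le_add2 le_trans Suc_le_lessD)
    with step show ?case by simp
  qed
  have "std_key n b k < std_key n b l" if "\<pi> k < \<pi> l" "k \<in> {1..n}" "l \<in> {1..n}" for k l
    using mono[of "\<pi> k" "\<pi> l"] that permutes_in_image[OF \<pi>] permutes_inverses[OF \<pi>]
    by (metis Suc_eq_plus1 Suc_leI atLeastAtMost_iff)
  from this[of k l] this[of l k] show ?thesis
    using kl permutes_inj[OF \<pi>] by (metis injD less_asym less_irrefl linorder_less_linear)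
qed

section \<open>Coding pairs of values by their ranks\<close>

text \<open>Ranks the pairs \<open>(a, b)\<close> lexicographically, the second entry in reversed order when \<open>a\<close> is odd.
  Since \<open>2 * j + 1\<close> is odd, the rank is even iff \<open>a + b\<close> is.\<close>

definition enc :: "nat \<Rightarrow> nat \<Rightarrow> nat \<Rightarrow> nat" where
  "enc j a b = a * (2 * j + 1) + (if even a then b else 2 * j - b)"

lemma enc_less_iff:
  assumes "b \<le> 2 * j" "b' \<le> 2 * j"
  shows "enc j a b < enc j a' b' \<longleftrightarrow> a < a' \<or> a = a' \<and> (if even a then b < b' else b' < b)"
proof -
  have "(if even a then b else 2 * j - b) < 2 * j + 1" "(if even a' then b' else 2 * j - b') < 2 * j + 1"
    using assms by auto
  from block_less_iff[OF this, of a a'] show ?thesis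
    unfolding enc_def using assms by auto
qed

lemma enc_eq_iff:
  assumes "b \<le> 2 * j" "b' \<le> 2 * j"
  shows "enc j a b = enc j a' b' \<longleftrightarrow> a = a' \<and> b = b'"
  using enc_less_iff[OF assms, of a a'] enc_less_iff[OF assms(2,1), of a' a]
  by (cases a a' rule: linorder_cases; cases b b' rule: linorder_cases) (auto split: if_splits)

lemma even_enc_iff:
  assumes "b \<le> 2 * j"
  shows "even (enc j a b) \<longleftrightarrow> (even a \<longleftrightarrow> even b)"
  using assms unfolding enc_def by auto

text \<open>A code may repeat iff \<open>a\<close> and \<open>b\<close> have equal parity. For equal
  entries \<open>a\<close>, the comparison of codes asks for the ascent condition
  \<open>b < b' \<or> b = b' \<and> even b\<close> when \<open>a\<close> is even and, the order
  being reversed, for its negation when \<open>a\<close> is odd.\<close>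

lemma step_ok_enc:
  assumes "b \<le> 2 * j" "b' \<le> 2 * j"
  shows "step_ok True (enc j a b) (enc j a' b') \<longleftrightarrow>
    step_ok (b < b' \<or> b = b' \<and> even b) a a'"
  unfolding step_ok_def enc_less_iff[OF assms] enc_eq_iff[OF assms] even_enc_iff[OF assms(1)]
  by auto

lemma enc_le:
  assumes "a \<le> 2 * i" "b \<le> 2 * j"
  shows "enc j a b \<le> 2 * (2 * i * j + i + j)"
proof -
  have "a * (2 * j + 1) \<le> 2 * i * (2 * j + 1)" using assms by (intro mult_le_mono1)
  moreover have "(if even a then b else 2 * j - b) \<le> 2 * j" using assms by auto
  ultimately show ?thesis unfolding enc_def by (simp add: algebra_simps)
qed

lemma enc_surj:
  assumes "c \<le> 2 * (2 * i * j + i + j)"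
  obtains a b where "a \<le> 2 * i" "b \<le> 2 * j" "c = enc j a b"
proof -
  define a r where "a = c div (2 * j + 1)" "r = c mod (2 * j + 1)"
  have c: "c = a * (2 * j + 1) + r" unfolding a_r_def by (simp only: div_mult_mod_eq)
  have r: "r \<le> 2 * j" unfolding a_r_def using mod_less_divisor[of "2 * j + 1" c] by linarith
  \<comment> \<open>Uses (2i + 1)(2j + 1) = 2(2ij + i + j) + 1, the total number of codes.\<close>
  have "a * (2 * j + 1) < (2 * i + 1) * (2 * j + 1)" using assms c by (simp add: algebra_simps)
  then have "a < 2 * i + 1" by (simp only: mult_less_cancel2)
  then have "a \<le> 2 * i" by simp
  moreover have "c = enc j a (if even a then r else 2 * j - r)"
    unfolding enc_def using c r by auto
  moreover have "(if even a then r else 2 * j - r) \<le> 2 * j" using r by auto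
  ultimately show thesis using that by blast
qed

text \<open>The bijection sends (\<pi>, f, g) to the word of codes of the pairs (f k, g (\<pi> k)).
  The second entries form a word whose standardization is \<pi>, so \<pi> and then g can be
  recovered from it.\<close>

lemma sum_card_lepp_mult:
  "(\<Sum>\<pi> | \<pi> permutes {1..n}. card (lepp n \<pi> (2 * i)) * card (lepp n (inv \<pi>) (2 * j))) =
     card (lepp n id (2 * (2 * i * j + i + j)))"
proof -
  let ?N = "2 * i * j + i + j"
  define X where "X = (SIGMA \<pi>:{\<pi>. \<pi> permutes {1..n}}. lepp n \<pi> (2 * i) \<times> lepp n (inv \<pi>) (2 * j))"
  define \<Phi> where "\<Phi> = (\<lambda>(\<pi> :: nat \<Rightarrow> nat, f, g). \<lambda>k\<in>{1..n}. enc j (f k) (g (\<pi> k)))"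
  \<comment> \<open>By standardization, \<pi> ascends at \<open>k\<close> iff
    \<open>b k < b (k + 1)\<close> or both are equal and even, which is the condition in
    \<open>step_ok_enc\<close>.\<close>
  have key: "(\<forall>k\<in>{1..<n}. step_ok (\<pi> k < \<pi> (k + 1)) (f k) (f (k + 1))) \<longleftrightarrow>
      (\<forall>k\<in>{1..<n}. step_ok True (enc j (f k) (b k)) (enc j (f (k + 1)) (b (k + 1))))"
    if \<pi>: "\<pi> permutes {1..n}" and b: "b \<in> {1..n} \<rightarrow> {..2 * j}"
      and std: "(\<lambda>m\<in>{1..n}. b (inv \<pi> m)) \<in> lepp n (inv \<pi>) (2 * j)" for \<pi> b f
  proof (rule ball_cong[OF refl])
    fix k assume "k \<in> {1..<n}"
    then have k: "k \<in> {1..n}" "k + 1 \<in> {1..n}" by auto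
    then have "b k \<le> 2 * j" "b (k + 1) \<le> 2 * j" using b by auto
    moreover have "\<pi> k < \<pi> (k + 1) \<longleftrightarrow> b k < b (k + 1) \<or> b k = b (k + 1) \<and> even (b k)"
      using standardization_less_iff[OF \<pi> b std k] std_key_less_iff[OF k, of b] by auto
    ultimately show "step_ok (\<pi> k < \<pi> (k + 1)) (f k) (f (k + 1)) \<longleftrightarrow>
        step_ok True (enc j (f k) (b k)) (enc j (f (k + 1)) (b (k + 1)))"
      by (simp add: step_ok_enc)
  qed
  have XD: "\<pi> permutes {1..n}" "f \<in> {1..n} \<rightarrow>\<^sub>E {..2 * i}" "(\<lambda>k. g (\<pi> k)) \<in> {1..n} \<rightarrow> {..2 * j}"
    "(\<lambda>m\<in>{1..n}. g (\<pi> (inv \<pi> m))) = g" if "(\<pi>, f, g) \<in> X" for \<pi> f g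
  proof -
    show \<pi>: "\<pi> permutes {1..n}" and "f \<in> {1..n} \<rightarrow>\<^sub>E {..2 * i}"
      using that unfolding X_def lepp_def by auto
    have g: "g \<in> {1..n} \<rightarrow>\<^sub>E {..2 * j}" using that unfolding X_def lepp_def by auto
    then show "(\<lambda>k. g (\<pi> k)) \<in> {1..n} \<rightarrow> {..2 * j}"
      using permutes_in_image[OF \<pi>] by (auto simp: PiE_iff simp del: atLeastAtMost_iff)
    show "(\<lambda>m\<in>{1..n}. g (\<pi> (inv \<pi> m))) = g"
      using g by (auto simp: permutes_inverses[OF \<pi>] PiE_iff extensional_def fun_eq_iff)
  qed
  have "bij_betw \<Phi> X (lepp n id (2 * ?N))"
    unfolding bij_betw_def
  proof (intro conjI equalityI subsetI)
    show "inj_on \<Phi> X"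
    proof (rule inj_onI)
      fix x x' assume xx': "x \<in> X" "x' \<in> X" "\<Phi> x = \<Phi> x'"
      obtain \<pi> f g \<pi>' f' g' where x: "x = (\<pi>, f, g)" "x' = (\<pi>', f', g')"
        by (metis prod_cases3)
      note X = xx'(1,2)[unfolded x] and eq = xx'(3)[unfolded x]
      have *: "f k = f' k \<and> g (\<pi> k) = g' (\<pi>' k)" if k: "k \<in> {1..n}" for k
      proof -
        have "enc j (f k) (g (\<pi> k)) = enc j (f' k) (g' (\<pi>' k))"
          using fun_cong[OF eq, of k] k unfolding \<Phi>_def by simp
        moreover have "g (\<pi> k) \<le> 2 * j" "g' (\<pi>' k) \<le> 2 * j"
          using XD(3)[OF X(1)] XD(3)[OF X(2)] k by auto
        ultimately show ?thesis by (simp add: enc_eq_iff)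
      qed
      have "f = f'" using XD(2)[OF X(1)] XD(2)[OF X(2)] * by (metis PiE_ext)
      have b: "(\<lambda>k. g (\<pi> k)) \<in> {1..n} \<rightarrow> {..2 * j}" by (rule XD(3)[OF X(1)])
      have std: "(\<lambda>m\<in>{1..n}. g (\<pi> (inv \<pi> m))) \<in> lepp n (inv \<pi>) (2 * j)"
        using XD(4)[OF X(1)] X(1) unfolding X_def by simp
      have mem: "inv \<pi>' m \<in> {1..n}" if "m \<in> {1..n}" for m
        using permutes_in_image[OF permutes_inv[OF XD(1)[OF X(2)]]] that by blast
      \<comment> \<open>\<pi> and \<pi>' now standardize the same word \<open>g (\<pi> k)\<close>,
        so uniqueness identifies them.\<close>
      have g': "(\<lambda>m\<in>{1..n}. g (\<pi> (inv \<pi>' m))) = (\<lambda>m\<in>{1..n}. g' (\<pi>' (inv \<pi>' m)))"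
        using * mem by (intro restrict_ext) blast
      then have "(\<lambda>m\<in>{1..n}. g (\<pi> (inv \<pi>' m))) \<in> lepp n (inv \<pi>') (2 * j)"
        using XD(4)[OF X(2)] X(2) unfolding X_def by simp
      then have "\<pi> = \<pi>'"
        using ex1_standardization[OF b] std XD(1)[OF X(1)] XD(1)[OF X(2)] by blast
      moreover from this have "g = g'" using g' XD(4)[OF X(1)] XD(4)[OF X(2)] by simp
      ultimately show "x = x'" using \<open>f = f'\<close> x by blast
    qed
  next
    fix h assume "h \<in> \<Phi> ` X"
    then obtain \<pi> f g where X: "(\<pi>, f, g) \<in> X" and h: "h = \<Phi> (\<pi>, f, g)" by auto
    have std: "(\<lambda>m\<in>{1..n}. g (\<pi> (inv \<pi> m))) \<in> lepp n (inv \<pi>) (2 * j)"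
      using XD(4)[OF X] X unfolding X_def by simp
    have "\<forall>k\<in>{1..<n}. step_ok (\<pi> k < \<pi> (k + 1)) (f k) (f (k + 1))"
      using X unfolding X_def lepp_def by simp
    then have "\<forall>k\<in>{1..<n}. step_ok True (h k) (h (k + 1))"
      unfolding key[OF XD(1,3)[OF X] std] h \<Phi>_def by simp
    moreover have "h k \<le> 2 * ?N" if "k \<in> {1..n}" for k
    proof -
      have "f k \<le> 2 * i" "g (\<pi> k) \<le> 2 * j" using XD(2,3)[OF X] that by auto
      then show ?thesis using enc_le that unfolding h \<Phi>_def by simp
    qed
    ultimately show "h \<in> lepp n id (2 * ?N)"
      unfolding lepp_def by (auto simp: h \<Phi>_def)
  next
    fix h assume h: "h \<in> lepp n id (2 * ?N)"
    have "\<forall>k\<in>{1..n}. \<exists>a b. a \<le> 2 * i \<and> b \<le> 2 * j \<and> h k = enc j a b"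
    proof
      fix k assume "k \<in> {1..n}"
      then have "h k \<le> 2 * ?N" using h unfolding lepp_def by auto
      then show "\<exists>a b. a \<le> 2 * i \<and> b \<le> 2 * j \<and> h k = enc j a b" using enc_surj by metis
    qed
    then obtain f b where fb: "\<forall>k\<in>{1..n}. f k \<le> 2 * i \<and> b k \<le> 2 * j \<and> h k = enc j (f k) (b k)"
      by metis
    then have b: "b \<in> {1..n} \<rightarrow> {..2 * j}" by auto
    then obtain \<pi> where \<pi>: "\<pi> permutes {1..n}"
      and std: "(\<lambda>m\<in>{1..n}. b (inv \<pi> m)) \<in> lepp n (inv \<pi>) (2 * j)"
      using ex1_standardization by blast
    have "\<forall>k\<in>{1..<n}. step_ok True (h k) (h (k + 1))"
      using h unfolding lepp_def by simp
    then have "\<forall>k\<in>{1..<n}. step_ok True (enc j (f k) (b k)) (enc j (f (k + 1)) (b (k + 1)))"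
      using fb by simp
    then have "\<forall>k\<in>{1..<n}. step_ok (\<pi> k < \<pi> (k + 1)) (f k) (f (k + 1))"
      unfolding key[OF \<pi> b std] .
    then have "restrict f {1..n} \<in> lepp n \<pi> (2 * i)"
      using fb unfolding lepp_def by auto
    then have "(\<pi>, restrict f {1..n}, \<lambda>m\<in>{1..n}. b (inv \<pi> m)) \<in> X"
      using \<pi> std unfolding X_def by simp
    moreover have "h = \<Phi> (\<pi>, restrict f {1..n}, \<lambda>m\<in>{1..n}. b (inv \<pi> m))"
    proof
      fix k
      show "h k = \<Phi> (\<pi>, restrict f {1..n}, \<lambda>m\<in>{1..n}. b (inv \<pi> m)) k"
      proof (cases "k \<in> {1..n}")
        case True
        moreover have "\<pi> k \<in> {1..n}" using True permutes_in_image[OF \<pi>] by blast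
        ultimately show ?thesis
          using fb unfolding \<Phi>_def by (simp add: permutes_inverses[OF \<pi>])
      next
        case False
        then show ?thesis using h unfolding \<Phi>_def lepp_def by (auto simp: PiE_iff extensional_def)
      qed
    qed
    ultimately show "h \<in> \<Phi> ` X" by blast
  qed
  then have "card X = card (lepp n id (2 * ?N))" by (rule bij_betw_same_card)
  moreover have "card X = (\<Sum>\<pi> | \<pi> permutes {1..n}. card (lepp n \<pi> (2 * i)) * card (lepp n (inv \<pi>) (2 * j)))"
    unfolding X_def by (subst card_SigmaI) (auto simp: finite_permutations card_cartesian_product)
  ultimately show ?thesis by simp
qed

section \<open>Odd cycles\<close>

lemma permutes_imp_self_in_orbit:
  assumes "finite S" "\<pi> permutes S"
  shows "x \<in> orbit \<pi> x"
  by (rule permutation_self_in_orbit) (use assms permutation_permutes in blast)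

lemma orbit_subset_permutes:
  assumes "\<pi> permutes S" "x \<in> S"
  shows "orbit \<pi> x \<subseteq> S"
proof
  fix y assume "y \<in> orbit \<pi> x"
  then show "y \<in> S"
    by induction (use assms permutes_in_image[OF assms(1)] in auto)
qed

lemma orbit_eq_iff_mem:
  assumes "finite S" "\<pi> permutes S"
  shows "orbit \<pi> x = orbit \<pi> y \<longleftrightarrow> x \<in> orbit \<pi> y"
  using permutes_imp_self_in_orbit[OF assms] orbit_swap orbit_trans by (metis subsetI subset_antisym)

lemma orbit_fixpoint: "\<pi> x = x \<Longrightarrow> orbit \<pi> x = {x}"
proof -
  assume fp: "\<pi> x = x"
  have "y = x" if "y \<in> orbit \<pi> x" for y using that by induction (auto simp: fp)
  then show ?thesis using orbit.base[of \<pi> x] fp by auto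
qed

text \<open>Composing with the transposition inserts \<open>a\<close> immediately before
  \<open>b\<close> in the cycle of \<open>b\<close> and leaves all other cycles alone.\<close>

lemma orbits_transpose_insert:
  assumes S: "finite S" and q: "q permutes S" and a: "a \<notin> S" and b: "b \<in> S"
  shows "orbit (transpose a b \<circ> q) ` insert a S = insert (insert a (orbit q b)) (orbit q ` S - {orbit q b})"
proof -
  define \<pi> where "\<pi> = transpose a b \<circ> q"
  have qa: "q a = a" using q a by (simp add: permutes_not_in)
  have ab: "a \<noteq> b" using a b by auto
  have \<pi>: "\<pi> permutes insert a S"
    unfolding \<pi>_def using q b permutes_subset[OF q, of "insert a S"]
    by (intro permutes_compose) (auto intro: permutes_swap_id)
  have fin: "finite (insert a S)" using S by simp
  note self = permutes_imp_self_in_orbit[OF S q] permutes_imp_self_in_orbit[OF fin \<pi>]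
  note sub = orbit_subset_permutes[OF q]
  have \<pi>a: "\<pi> a = b" unfolding \<pi>_def using qa by simp
  have \<pi>x: "\<pi> x = (if q x = b then a else q x)" if "x \<in> S" for x
    unfolding \<pi>_def using that a permutes_in_image[OF q, of x] by (auto simp: transpose_def)
  \<comment> \<open>The new orbit follows the old one, with a detour through \<open>a\<close> on
    each arrival at \<open>b\<close>.\<close>
  have incl: "orbit q x \<subseteq> orbit \<pi> x" if "x \<in> S" for x
  proof
    fix y assume "y \<in> orbit q x"
    then show "y \<in> orbit \<pi> x"
    proof induction
      case base
      show ?case
      proof (cases "q x = b")
        case True
        then have "a \<in> orbit \<pi> x" using \<pi>x[OF that] orbit.base[of \<pi> x] by simp
        then show ?thesis using orbit.step[of a \<pi> x] \<pi>a True by simp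
      next
        case False
        then show ?thesis using \<pi>x[OF that] orbit.base[of \<pi> x] by simp
      qed
    next
      case (step y)
      then have "y \<in> S" using sub[OF that] by blast
      show ?case
      proof (cases "q y = b")
        case True
        then have "a \<in> orbit \<pi> x" using \<pi>x[OF \<open>y \<in> S\<close>] orbit.step[OF step.IH] by simp
        then show ?thesis using orbit.step[of a \<pi> x] \<pi>a True by simp
      next
        case False
        then show ?thesis using \<pi>x[OF \<open>y \<in> S\<close>] orbit.step[OF step.IH] by simp
      qed
    qed
  qed
  \<comment> \<open>Recording \<open>b \<in> orbit q x\<close> together with \<open>y = a\<close> is
    what carries the induction through the step from \<open>a\<close> to \<open>b\<close>.\<close>
  have incl': "y \<in> orbit q x \<or> y = a \<and> b \<in> orbit q x" if "x \<in> S" "y \<in> orbit \<pi> x" for x y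
    using that(2)
  proof induction
    case base
    show ?case using \<pi>x[OF that(1)] orbit.base[of q x] by auto
  next
    case (step y)
    show ?case
    proof (cases "y = a")
      case True
      then show ?thesis using step.IH sub[OF that(1)] a \<pi>a by auto
    next
      case False
      then have y: "y \<in> orbit q x" using step.IH by blast
      then have "y \<in> S" using sub[OF that(1)] by blast
      then show ?thesis using \<pi>x[of y] orbit.step[OF y] by auto
    qed
  qed
  have a_in: "a \<in> orbit \<pi> b"
    using orbit_swap[of a \<pi> b] self orbit.base[of \<pi> a] \<pi>a by simp
  have orb_b: "orbit \<pi> b = insert a (orbit q b)"
    using incl[OF b] incl'[OF b] a_in by auto
  have orb_a: "orbit \<pi> a = orbit \<pi> b"
    using orbit_eq_iff_mem[OF fin \<pi>] a_in by blast
  have orb_other: "orbit \<pi> x = orbit q x" if "x \<in> S" "b \<notin> orbit q x" for x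
    using incl[OF that(1)] incl'[OF that(1)] that(2) by blast
  have orb_same: "orbit \<pi> x = orbit \<pi> b" if "x \<in> S" "b \<in> orbit q x" for x
    using orbit_eq_iff_mem[OF fin \<pi>] incl[OF that(1)] that(2) by blast
  have iff: "b \<in> orbit q x \<longleftrightarrow> orbit q x = orbit q b" for x
    using orbit_eq_iff_mem[OF S q] by metis
  show ?thesis unfolding \<pi>_def[symmetric]
  proof (intro equalityI subsetI)
    fix C assume "C \<in> orbit \<pi> ` insert a S"
    then obtain x where x: "x \<in> insert a S" "C = orbit \<pi> x" by blast
    show "C \<in> insert (insert a (orbit q b)) (orbit q ` S - {orbit q b})"
    proof (cases "x \<in> S \<and> b \<notin> orbit q x")
      case True
      then show ?thesis using x orb_other[of x] iff[of x] by blast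
    next
      case False
      then have "orbit \<pi> x = orbit \<pi> b" using x(1) orb_a orb_same by blast
      then show ?thesis using x(2) orb_b by blast
    qed
  next
    fix C assume "C \<in> insert (insert a (orbit q b)) (orbit q ` S - {orbit q b})"
    then consider "C = orbit \<pi> b" | x where "x \<in> S" "C = orbit q x" "orbit q x \<noteq> orbit q b"
      using orb_b by blast
    then show "C \<in> orbit \<pi> ` insert a S"
      by cases (use b orb_other iff in blast)+
  qed
qed

section \<open>Counting permutations of a finite set by odd cycles\<close>

definition num_odd_cycles :: "('a \<Rightarrow> 'a) \<Rightarrow> 'a set \<Rightarrow> nat" where
  "num_odd_cycles \<pi> S = card {C \<in> orbit \<pi> ` S. odd (card C)}"

lemma num_odd_cycles_insert_fixpoint:
  assumes "finite S" "q permutes S" "a \<notin> S"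
  shows "num_odd_cycles q (insert a S) = num_odd_cycles q S + 1"
proof -
  have "orbit q a = {a}" using assms by (intro orbit_fixpoint) (simp add: permutes_not_in)
  then have "{C \<in> orbit q ` insert a S. odd (card C)} = insert {a} {C \<in> orbit q ` S. odd (card C)}"
    by auto
  moreover have "{a} \<notin> orbit q ` S"
    using orbit_subset_permutes[OF assms(2)] assms(3) by (metis imageE insert_subset)
  ultimately show ?thesis using assms(1) unfolding num_odd_cycles_def by simp
qed

text \<open>Here \<open>b\<close> is fixed by \<open>q\<close>, so inserting \<open>a\<close>
  creates the even cycle {a, b}.\<close>

lemma num_odd_cycles_insert_two_cycle:
  assumes T: "finite T" "q permutes T" "a \<notin> T" "b \<notin> T" "a \<noteq> b"
  shows "num_odd_cycles (transpose a b \<circ> q) (insert a (insert b T)) = num_odd_cycles q T"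
proof -
  have q: "q permutes insert b T" using permutes_subset[OF T(2)] by blast
  have b: "orbit q b = {b}" using T by (intro orbit_fixpoint) (simp add: permutes_not_in)
  have "{b} \<notin> orbit q ` T"
    using orbit_subset_permutes[OF T(2)] T(4) by (metis imageE insert_subset)
  then have "orbit (transpose a b \<circ> q) ` insert a (insert b T) = insert {a, b} (orbit q ` T)"
    using orbits_transpose_insert[OF _ q, of a b] T b by auto
  then have "{C \<in> orbit (transpose a b \<circ> q) ` insert a (insert b T). odd (card C)} =
      {C \<in> orbit q ` T. odd (card C)}"
    using T(5) by auto
  then show ?thesis unfolding num_odd_cycles_def by simp
qed

text \<open>First \<open>b\<close> and then \<open>a\<close> enter the cycle of \<open>c\<close>.
  Its length grows by two and keeps its parity.\<close>

lemma num_odd_cycles_insert_pair: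
  assumes T: "finite T" "q permutes T" "a \<notin> T" "b \<notin> T" "a \<noteq> b" "c \<in> T"
  shows "num_odd_cycles (transpose a b \<circ> (transpose b c \<circ> q)) (insert a (insert b T)) = num_odd_cycles q T"
proof -
  let ?D = "orbit q c"
  let ?r = "transpose b c \<circ> q"
  define R where "R = orbit q ` T - {?D}"
  have D: "?D \<subseteq> T" using orbit_subset_permutes[OF T(2,6)] .
  have R_sub: "C \<subseteq> T" if "C \<in> R" for C using that orbit_subset_permutes[OF T(2)] unfolding R_def by blast
  have r: "?r permutes insert b T"
    using T permutes_subset[OF T(2), of "insert b T"]
    by (intro permutes_compose) (auto intro: permutes_swap_id)
  have 1: "orbit ?r ` insert b T = insert (insert b ?D) R"
    using orbits_transpose_insert[OF T(1,2,4,6)] unfolding R_def .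
  have orb: "orbit ?r b = insert b ?D"
  proof -
    have "orbit ?r b \<in> insert (insert b ?D) R" using 1 by blast
    moreover have "b \<in> orbit ?r b" using permutes_imp_self_in_orbit[OF _ r] T(1) by simp
    ultimately show ?thesis using R_sub T(4) by blast
  qed
  have "insert b ?D \<notin> R" using R_sub T(4) by blast
  moreover have "orbit (transpose a b \<circ> ?r) ` insert a (insert b T) =
      insert (insert a (orbit ?r b)) (orbit ?r ` insert b T - {orbit ?r b})"
    by (rule orbits_transpose_insert[OF _ r]) (use T in auto)
  ultimately have 2: "orbit (transpose a b \<circ> ?r) ` insert a (insert b T) = insert (insert a (insert b ?D)) R"
    unfolding 1 orb by simp
  have fin: "finite ?D" using D T(1) finite_subset by blast
  have card: "card (insert a (insert b ?D)) = card ?D + 2"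
    using D T fin by (subst card_insert_disjoint; auto)+
  \<comment> \<open>Neither the old nor the enlarged cycle is among the remaining orbits
    \<open>R\<close>, so each adds the same amount to the count.\<close>
  have new: "insert a (insert b ?D) \<notin> R" using R_sub T(4) by blast
  have D_notin: "?D \<notin> R" unfolding R_def by blast
  let ?O = "\<lambda>A. {C \<in> A. odd (card C)}"
  have finR: "finite (?O R)" using T(1) unfolding R_def by simp
  have T_eq: "orbit q ` T = insert ?D R" using T(6) unfolding R_def by blast
  have ins: "?O (insert C A) = (if odd (card C) then insert C (?O A) else ?O A)" for C and A :: "'a set set"
    by auto
  have "card (?O (insert (insert a (insert b ?D)) R)) = card (?O (insert ?D R))"
    unfolding ins using card new finR D_notin by simp
  then show ?thesis unfolding num_odd_cycles_def 2 T_eq[symmetric] .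
qed

definition odd_cycle_sum :: "'b::comm_semiring_1 \<Rightarrow> 'a set \<Rightarrow> 'b" where
  "odd_cycle_sum y S = (\<Sum>\<pi> | \<pi> permutes S. y ^ num_odd_cycles \<pi> S)"

text \<open>Classifies \<pi> by the image \<open>b\<close> of \<open>a\<close>. If
  \<open>b = a\<close>, a fixed point contributes \<open>y\<close>. Otherwise the image
  \<open>c\<close> of \<open>b\<close> is split off as well: the weight depends only on the
  remaining permutation of \<open>S - {b}\<close>, and \<open>c\<close> has \<open>card S\<close>
  choices.\<close>

lemma odd_cycle_sum_insert:
  assumes S: "finite S" and a: "a \<notin> S"
  shows "odd_cycle_sum y (insert a S) =
    y * odd_cycle_sum y S + of_nat (card S) * (\<Sum>b\<in>S. odd_cycle_sum y (S - {b}))"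
proof -
  let ?w = "\<lambda>\<pi>. y ^ num_odd_cycles \<pi> (insert a S)"
  have fixed: "(\<Sum>q | q permutes S. ?w (transpose a a \<circ> q)) = y * odd_cycle_sum y S"
    unfolding odd_cycle_sum_def sum_distrib_left using S a
    by (intro sum.cong) (auto simp: num_odd_cycles_insert_fixpoint)
  have moved: "(\<Sum>q | q permutes S. ?w (transpose a b \<circ> q)) = of_nat (card S) * odd_cycle_sum y (S - {b})"
    if b: "b \<in> S" for b
  proof -
    define T where "T = S - {b}"
    have T: "S = insert b T" "finite T" "a \<notin> T" "b \<notin> T" "a \<noteq> b"
      unfolding T_def using S a b by auto
    have "(\<Sum>q | q permutes S. ?w (transpose a b \<circ> q)) =
        (\<Sum>c\<in>insert b T. \<Sum>r | r permutes T. ?w (transpose a b \<circ> (transpose b c \<circ> r)))"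
      unfolding T(1) using T by (intro sum_over_permutations_insert)
    also have "\<dots> = (\<Sum>c\<in>insert b T. odd_cycle_sum y T)"
    proof (intro sum.cong refl)
      fix c assume c: "c \<in> insert b T"
      have "num_odd_cycles (transpose a b \<circ> (transpose b c \<circ> r)) (insert a S) = num_odd_cycles r T"
        if "r permutes T" for r
        using c num_odd_cycles_insert_two_cycle[OF T(2) that T(3-5)]
          num_odd_cycles_insert_pair[OF T(2) that T(3-5)] T(1) by (cases "c = b") auto
      then show "(\<Sum>r | r permutes T. ?w (transpose a b \<circ> (transpose b c \<circ> r))) = odd_cycle_sum y T"
        unfolding odd_cycle_sum_def by (intro sum.cong) auto
    qed
    finally show ?thesis unfolding T(1)[symmetric] by (simp add: T_def)
  qed
  have "odd_cycle_sum y (insert a S) =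
      (\<Sum>b\<in>insert a S. \<Sum>q | q permutes S. ?w (transpose a b \<circ> q))"
    unfolding odd_cycle_sum_def using S a by (rule sum_over_permutations_insert)
  also have "\<dots> = y * odd_cycle_sum y S + (\<Sum>b\<in>S. of_nat (card S) * odd_cycle_sum y (S - {b}))"
    using S a fixed moved by simp
  finally show ?thesis by (simp add: sum_distrib_left)
qed

section \<open>Delannoy numbers as counts of identity partitions and of odd cycles\<close>

lemma lepp_gf_id:
  assumes "n \<ge> 1"
  shows "lepp_gf n id = delannoy n"
  unfolding delannoy_eq_iff using lepp_gf_eq[OF assms, of id] by (simp add: lpk_id)

text \<open>With y = 2N + 1, the insertion recurrence E_(n+1) = y E_n + n^2 E_(n-1) is a factorial
  multiple of \<open>delannoy_three_term\<close>.\<close>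

lemma odd_cycle_sum_delannoy:
  assumes "finite S"
  shows "odd_cycle_sum (of_nat (2 * N + 1)) S = fact (card S) * delannoy N $ card S"
  using assms
proof (induction "card S" arbitrary: S rule: less_induct)
  case less
  show ?case
  proof (cases "S = {}")
    case True
    then show ?thesis
      by (simp add: odd_cycle_sum_def num_odd_cycles_def delannoy_nth_0)
  next
    case False
    then obtain a T where S: "S = insert a T" "a \<notin> T" by (metis ex_in_conv mk_disjoint_insert)
    then have T: "finite T" "card S = Suc (card T)" using less.prems by auto
    define y where "y = (of_nat (2 * N + 1) :: rat)"
    have IH: "odd_cycle_sum y U = fact (card U) * delannoy N $ card U" if "U \<subseteq> T" for U
      unfolding y_def using that T by (intro less.hyps) (auto simp: less_Suc_eq_le card_mono finite_subset)
    \<comment> \<open>For empty \<open>T\<close> the sum is empty, so the truncated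
      \<open>card T - 1\<close> does no harm.\<close>
    have E: "odd_cycle_sum y S = y * (fact (card T) * delannoy N $ card T) +
        of_nat (card T) * (\<Sum>b\<in>T. fact (card T - 1) * delannoy N $ (card T - 1))"
      unfolding S(1) odd_cycle_sum_insert[OF T(1) S(2)] using T(1) by (simp add: IH)
    show ?thesis
      unfolding y_def[symmetric]
    proof (cases "card T")
      case 0
      then show "odd_cycle_sum y S = fact (card S) * delannoy N $ card S"
        using E T(2) delannoy_nth_1[of N] by (simp add: delannoy_nth_0 y_def)
    next
      case (Suc m)
      have "odd_cycle_sum y S =
          fact (m + 1) * (y * delannoy N $ (m + 1) + of_nat (m + 1) * delannoy N $ m)"
        unfolding E Suc by (simp add: Suc algebra_simps)
      also have "\<dots> = fact (card S) * delannoy N $ card S"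
        unfolding y_def delannoy_three_term[symmetric] T(2) Suc by (simp add: algebra_simps)
      finally show "odd_cycle_sum y S = fact (card S) * delannoy N $ card S" .
    qed
  qed
qed

lemma sum_e_odd:
  "(\<Sum>k=0..n. of_nat (e_odd n k) * y ^ k) = odd_cycle_sum (y :: 'a::comm_semiring_1) {1..n}"
proof -
  have le: "num_odd_cycles \<pi> {1..n} \<le> n" for \<pi>
  proof -
    have "num_odd_cycles \<pi> {1..n} \<le> card (orbit \<pi> ` {1..n})"
      unfolding num_odd_cycles_def by (intro card_mono) auto
    also have "\<dots> \<le> n" using card_image_le[of "{1..n}" "orbit \<pi>"] by simp
    finally show ?thesis .
  qed
  have "odd_cycle_sum y {1..n} =
      (\<Sum>k=0..n. \<Sum>\<pi> | \<pi> \<in> {\<pi>. \<pi> permutes {1..n}} \<and> num_odd_cycles \<pi> {1..n} = k. y ^ num_odd_cycles \<pi> {1..n})"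
    unfolding odd_cycle_sum_def using le
    by (intro sum.group[symmetric]) (auto simp: finite_permutations)
  also have "\<dots> = (\<Sum>k=0..n. of_nat (e_odd n k) * y ^ k)"
    by (intro sum.cong refl) (simp add: e_odd_def odd_cycles_def num_odd_cycles_def)
  finally show ?thesis by simp
qed

lemma delannoy_nth_e_odd:
  "delannoy n $ N = 1 / fact n * (\<Sum>k=0..n. of_nat (e_odd n k) * of_nat (2 * N + 1) ^ k)"
  unfolding sum_e_odd odd_cycle_sum_delannoy[OF finite_atLeastAtMost]
  by (simp add: delannoy_sym)

section \<open>Power series in two variables\<close>

text \<open>Substitution of \<open>t\<close> for the variable; substitution of \<open>s\<close> is \<^const>\<open>fps_const\<close>.\<close>

definition in_t :: "rat fps \<Rightarrow> rat fps fps" where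
  "in_t f = Abs_fps (\<lambda>j. fps_const (f $ j))"

lemma in_t_mult: "in_t (f * g) = in_t f * in_t g"
proof (intro fps_ext)
  fix j i
  show "in_t (f * g) $ j $ i = (in_t f * in_t g) $ j $ i"
    by (cases "i = 0") (simp_all add: in_t_def fps_mult_nth fps_sum_nth)
qed

lemma in_t_add: "in_t (f + g) = in_t f + in_t g"
  and in_t_diff: "in_t (f - g) = in_t f - in_t g"
  and in_t_const: "in_t (fps_const c) = fps_const (fps_const c)"
  and in_t_X: "in_t fps_X = fps_X"
  by (intro fps_ext; simp add: in_t_def fps_X_nth)+

lemma in_t_1: "in_t 1 = 1"
  using in_t_const[of 1] by simp

lemma in_t_power: "in_t (f ^ n) = in_t f ^ n"
  by (induction n) (simp_all add: in_t_1 in_t_mult)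

lemma in_t_numeral: "in_t (numeral k) = numeral k"
  by (simp add: numeral_fps_const in_t_const)

lemmas in_t_simps = in_t_mult in_t_add in_t_diff in_t_X in_t_1 in_t_power in_t_numeral

lemma fps_const_1_fps: "fps_const (1 :: rat fps) = 1" and
  fps_const_numeral_fps: "fps_const (numeral k :: rat fps) = numeral k"
  by (simp_all add: numeral_fps_const)

lemmas in_s_simps = fps_const_mult[symmetric] fps_const_add[symmetric] fps_const_sub[symmetric]
  fps_const_power[symmetric] fps_const_1_fps fps_const_numeral_fps

lemma mult_in_t: "fps_const f * in_t g = gf2 (\<lambda>i j. f $ i * g $ j)"
  by (intro fps_ext) (simp add: in_t_def gf2_def)

lemma fps_fps_divide_eqI:
  fixes f g h :: "rat fps fps"
  assumes "g $ 0 $ 0 \<noteq> 0" "f = h * g"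
  shows "f / g = h"
proof -
  have "g \<noteq> 0" using assms(1) by auto
  then show ?thesis using fps_fps_divide_times[OF assms(1), of f] assms(2) by simp
qed

lemma one_minus_vars_nth: "(((1 - var_s) * (1 - var_t)) ^ n) $ 0 $ 0 = 1"
  by (simp add: fps_nth_power_0)

text \<open>Product of two copies of \<open>lepp_gf_eq\<close>, one in s and one in t.\<close>

lemma lpk_term_eq:
  assumes "n \<ge> 1" "inj \<pi>" "inj \<sigma>"
  shows "((1 + var_s) * (1 + var_t)) ^ n / ((1 - var_s) * (1 - var_t)) ^ (n + 1)
      * ((4 * var_s / (1 + var_s) ^ 2) ^ lpk n \<pi> * (4 * var_t / (1 + var_t) ^ 2) ^ lpk n \<sigma>)
    = fps_const (lepp_gf n \<pi>) * in_t (lepp_gf n \<sigma>)"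
proof -
  let ?s = var_s and ?t = var_t and ?l = "lpk n \<pi>" and ?m = "lpk n \<sigma>"
  define A where "A = ((1 + ?s) * (1 + ?t)) ^ n / ((1 - ?s) * (1 - ?t)) ^ (n + 1)"
  define u where "u = 4 * ?s / (1 + ?s) ^ 2"
  define v where "v = 4 * ?t / (1 + ?t) ^ 2"
  define F where "F = fps_const (lepp_gf n \<pi>)"
  define G where "G = in_t (lepp_gf n \<sigma>)"
  have A: "A * ((1 - ?s) * (1 - ?t)) ^ (n + 1) = ((1 + ?s) * (1 + ?t)) ^ n"
    unfolding A_def by (rule fps_fps_divide_times) (use one_minus_vars_nth in simp)
  have s0: "((1 + ?s) ^ 2) $ 0 $ 0 = 1" and t0: "((1 + ?t) ^ 2) $ 0 $ 0 = 1"
    by (simp_all add: fps_nth_power_0)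
  have u: "u * (1 + ?s) ^ 2 = 4 * ?s"
    unfolding u_def by (rule fps_fps_divide_times) (use s0 in simp)
  have v: "v * (1 + ?t) ^ 2 = 4 * ?t"
    unfolding v_def by (rule fps_fps_divide_times) (use t0 in simp)
  have F: "(1 - ?s) ^ (n + 1) * (1 + ?s) ^ (2 * ?l) * F = (1 + ?s) ^ n * (4 * ?s) ^ ?l"
    using arg_cong[OF lepp_gf_eq[OF assms(1,2)], of fps_const]
    unfolding F_def in_s_simps .
  have G: "(1 - ?t) ^ (n + 1) * (1 + ?t) ^ (2 * ?m) * G = (1 + ?t) ^ n * (4 * ?t) ^ ?m"
    using arg_cong[OF lepp_gf_eq[OF assms(1,3)], of in_t]
    unfolding G_def in_t_simps .
  \<comment> \<open>The common denominator. Its constant term is 1, so it can be cancelled.\<close>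
  define K where "K = ((1 - ?s) * (1 - ?t)) ^ (n + 1) * ((1 + ?s) ^ 2) ^ ?l * ((1 + ?t) ^ 2) ^ ?m"
  have "K $ 0 $ 0 = 1" unfolding K_def by (simp add: fps_nth_power_0)
  then have "K \<noteq> 0" by auto
  have "A * (u ^ ?l * v ^ ?m) * K =
      (A * ((1 - ?s) * (1 - ?t)) ^ (n + 1)) * (u * (1 + ?s) ^ 2) ^ ?l * (v * (1 + ?t) ^ 2) ^ ?m"
    unfolding K_def by (simp only: power_mult_distrib mult_ac)
  also have "\<dots> = ((1 + ?s) ^ n * (4 * ?s) ^ ?l) * ((1 + ?t) ^ n * (4 * ?t) ^ ?m)"
    unfolding A u v by (simp only: power_mult_distrib mult_ac)
  also have "\<dots> = F * G * K"
    unfolding F[symmetric] G[symmetric] K_def by (simp only: power_mult_distrib power_mult[symmetric] mult_ac)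
  finally show ?thesis
    using \<open>K \<noteq> 0\<close> unfolding A_def u_def v_def F_def G_def by (metis mult_cancel_right)
qed

lemma gf2_sum: "(\<Sum>x\<in>A. gf2 (c x)) = gf2 (\<lambda>i j. \<Sum>x\<in>A. c x i j)" for c :: "'b \<Rightarrow> nat \<Rightarrow> nat \<Rightarrow> rat"
  by (intro fps_ext) (simp add: gf2_def fps_sum_nth)

text \<open>The common source of all three parts. Each permutation contributes the pairs of
  partitions for it and its inverse, and \<open>sum_card_lepp_mult\<close> counts all these pairs as
  partitions of the identity.\<close>

lemma P_lpk_ilpk_gf2:
  assumes "n \<ge> 1"
  shows "((1 + var_s) * (1 + var_t)) ^ n / ((1 - var_s) * (1 - var_t)) ^ (n + 1)
          * P_lpk_ilpk n (4 * var_s / (1 + var_s) ^ 2) (4 * var_t / (1 + var_t) ^ 2)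
        = gf2 (\<lambda>i j. delannoy n $ (2 * i * j + i + j))" (is "?A * _ = _")
proof -
  have "?A * P_lpk_ilpk n (4 * var_s / (1 + var_s) ^ 2) (4 * var_t / (1 + var_t) ^ 2) =
      (\<Sum>\<pi> | \<pi> permutes {1..n}. fps_const (lepp_gf n \<pi>) * in_t (lepp_gf n (inv \<pi>)))"
    unfolding P_lpk_ilpk_def sum_distrib_left ilpk_def
  proof (intro sum.cong refl)
    fix \<pi> assume "\<pi> \<in> {\<pi>. \<pi> permutes {1..n}}"
    then have "inj \<pi>" "inj (inv \<pi>)" using permutes_inj permutes_inv by blast+
    then show "?A * ((4 * var_s / (1 + var_s) ^ 2) ^ lpk n \<pi> * (4 * var_t / (1 + var_t) ^ 2) ^ lpk n (inv \<pi>)) =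
        fps_const (lepp_gf n \<pi>) * in_t (lepp_gf n (inv \<pi>))"
      by (rule lpk_term_eq[OF assms])
  qed
  also have "\<dots> = gf2 (\<lambda>i j. \<Sum>\<pi> | \<pi> permutes {1..n}. lepp_gf n \<pi> $ i * lepp_gf n (inv \<pi>) $ j)"
    unfolding mult_in_t gf2_sum ..
  also have "\<dots> = gf2 (\<lambda>i j. lepp_gf n id $ (2 * i * j + i + j))"
    unfolding lepp_gf_def fps_nth_Abs_fps of_nat_mult[symmetric] of_nat_sum[symmetric]
      sum_card_lepp_mult ..
  finally show ?thesis unfolding lepp_gf_id[OF assms] .
qed

section \<open>The type B Eulerian side\<close>

lemma eval_poly2_pCons: "eval_poly2 (pCons a p) u = fps_const (fps_const a) + u * eval_poly2 p u"
  unfolding eval_poly2_def by (simp add: map_poly_pCons)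

lemma eval_poly2_var_s: "eval_poly2 p var_s = fps_const (fps_of_poly p)"
proof (induction p)
  case 0
  show ?case by (simp add: eval_poly2_def)
next
  case (pCons a p)
  then show ?case by (simp add: eval_poly2_pCons fps_of_poly_pCons mult.commute)
qed

lemma eval_poly2_var_t: "eval_poly2 p var_t = in_t (fps_of_poly p)"
proof (induction p)
  case 0
  show ?case using in_t_const[of 0] by (simp add: eval_poly2_def)
next
  case (pCons a p)
  then show ?case
    by (simp add: eval_poly2_pCons fps_of_poly_pCons in_t_simps in_t_const mult.commute)
qed

text \<open>The two defining series multiply to coefficients (2i + 1)^k (2j + 1)^k, and (2i + 1)(2j
  + 1) = 2(2ij + i + j) + 1.\<close>

lemma eulerian_B_product_gf2:
  "eval_poly2 (eulerian_B k) var_s * eval_poly2 (eulerian_B k) var_t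
     / ((1 - var_s) ^ (k + 1) * (1 - var_t) ^ (k + 1)) =
   gf2 (\<lambda>i j. of_nat (2 * (2 * i * j + i + j) + 1) ^ k)"
proof -
  define F :: "rat fps" where "F = Abs_fps (\<lambda>i. of_nat (2 * i + 1) ^ k)"
  have "((1 - fps_X) ^ (k + 1) :: rat fps) $ 0 \<noteq> 0" by (simp add: fps_nth_power_0)
  from fps_divide_eq_iff_mult[OF this] have B: "fps_of_poly (eulerian_B k) = F * (1 - fps_X) ^ (k + 1)"
    using eulerian_B[of k] unfolding F_def by blast
  have "eval_poly2 (eulerian_B k) var_s * eval_poly2 (eulerian_B k) var_t
     / ((1 - var_s) ^ (k + 1) * (1 - var_t) ^ (k + 1)) = fps_const F * in_t F"
  proof (rule fps_fps_divide_eqI)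
    show "((1 - var_s) ^ (k + 1) * (1 - var_t) ^ (k + 1)) $ 0 $ 0 \<noteq> 0"
      using one_minus_vars_nth[of "k + 1"] by (simp only: power_mult_distrib)
    show "eval_poly2 (eulerian_B k) var_s * eval_poly2 (eulerian_B k) var_t =
        fps_const F * in_t F * ((1 - var_s) ^ (k + 1) * (1 - var_t) ^ (k + 1))"
      unfolding eval_poly2_var_s eval_poly2_var_t B in_s_simps in_t_simps by (simp only: mult_ac)
  qed
  also have "\<dots> = gf2 (\<lambda>i j. of_nat (2 * (2 * i * j + i + j) + 1) ^ k)"
    unfolding mult_in_t F_def by (simp add: power_mult_distrib[symmetric] algebra_simps)
  finally show ?thesis .
qed

lemma gf2_delannoy_e_odd:
  "gf2 (\<lambda>i j. delannoy n $ (2 * i * j + i + j)) =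
   fps_const (fps_const (1 / fact n)) * (\<Sum>k=0..n. of_nat (e_odd n k) *
     gf2 (\<lambda>i j. of_nat (2 * (2 * i * j + i + j) + 1) ^ k))"
proof -
  have of_nat: "of_nat e * gf2 c = gf2 (\<lambda>i j. of_nat e * c i j)" for e and c :: "nat \<Rightarrow> nat \<Rightarrow> rat"
    unfolding fps_of_nat[symmetric] by (intro fps_ext) (simp add: gf2_def)
  have const: "fps_const (fps_const a) * gf2 c = gf2 (\<lambda>i j. a * c i j)"
    for a and c :: "nat \<Rightarrow> nat \<Rightarrow> rat"
    by (intro fps_ext) (simp add: gf2_def)
  show ?thesis unfolding of_nat gf2_sum const delannoy_nth_e_odd ..
qed

theorem theorem4p3:
  shows
    "(fps_const (1 / ((1 - var_s) * (1 - var_t)))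
        + Abs_fps (\<lambda>n. if n \<ge> 1 then
            ((1 + var_s) * (1 + var_t)) ^ n / ((1 - var_s) * (1 - var_t)) ^ (n + 1)
              * P_lpk_ilpk n (4 * var_s / (1 + var_s) ^ 2) (4 * var_t / (1 + var_t) ^ 2)
          else 0)
      = x_outermost (gf2 (\<lambda>i j.
            (1 + fps_X) ^ (2 * i * j + i + j) / (1 - fps_X) ^ (2 * i * j + i + j + 1))))
    \<and> (\<forall>n\<ge>1.
        ((1 + var_s) * (1 + var_t)) ^ n / ((1 - var_s) * (1 - var_t)) ^ (n + 1)
          * P_lpk_ilpk n (4 * var_s / (1 + var_s) ^ 2) (4 * var_t / (1 + var_t) ^ 2)
        = gf2 (\<lambda>i j. \<Sum>k=0..n.
            of_nat (((2 * i * j + i + j) choose k)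
                    * ((2 * i * j + i + j + n - k) choose (n - k)))))
    \<and> (\<forall>n\<ge>1.
        ((1 + var_s) * (1 + var_t)) ^ n / ((1 - var_s) * (1 - var_t)) ^ (n + 1)
          * P_lpk_ilpk n (4 * var_s / (1 + var_s) ^ 2) (4 * var_t / (1 + var_t) ^ 2)
        = fps_const (fps_const (1 / fact n))
          * (\<Sum>k=0..n. of_nat (e_odd n k)
              * (eval_poly2 (eulerian_B k) var_s * eval_poly2 (eulerian_B k) var_t
                 / ((1 - var_s) ^ (k + 1) * (1 - var_t) ^ (k + 1)))))"
proof (intro conjI allI impI)
  \<comment> \<open>Extracting x^n from \<open>delannoy N\<close> gives, by symmetry, the
    coefficient \<open>N\<close> of \<open>delannoy n\<close>.\<close>
  have x_outermost_nth: "x_outermost (gf2 (\<lambda>i j. delannoy (2 * i * j + i + j))) $ n =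
      gf2 (\<lambda>i j. delannoy n $ (2 * i * j + i + j))" for n
    unfolding x_outermost_def gf2_def by (simp add: delannoy_sym[of _ n])
  \<comment> \<open>The term for \<open>n = 0\<close>: every coefficient is 1, as are all
    coefficients of \<open>delannoy 0\<close>.\<close>
  have "1 / ((1 - var_s) * (1 - var_t)) = fps_const (delannoy 0) * in_t (delannoy 0)"
  proof (rule fps_fps_divide_eqI)
    have d: "(1 - fps_X) * delannoy 0 = 1" using delannoy_mult[of 0] by simp
    have "(1 - var_s) * fps_const (delannoy 0) = 1" "(1 - var_t) * in_t (delannoy 0) = 1"
      using arg_cong[OF d, of fps_const] arg_cong[OF d, of in_t]
      unfolding in_s_simps in_t_simps .
    then show "1 = fps_const (delannoy 0) * in_t (delannoy 0) * ((1 - var_s) * (1 - var_t))"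
      by algebra
  qed (use one_minus_vars_nth[of 1] in simp)
  then have const: "1 / ((1 - var_s) * (1 - var_t)) = gf2 (\<lambda>i j. delannoy 0 $ (2 * i * j + i + j))"
    unfolding mult_in_t delannoy_0_nth by simp
  show "fps_const (1 / ((1 - var_s) * (1 - var_t)))
        + Abs_fps (\<lambda>n. if n \<ge> 1 then
            ((1 + var_s) * (1 + var_t)) ^ n / ((1 - var_s) * (1 - var_t)) ^ (n + 1)
              * P_lpk_ilpk n (4 * var_s / (1 + var_s) ^ 2) (4 * var_t / (1 + var_t) ^ 2)
          else 0)
      = x_outermost (gf2 (\<lambda>i j.
            (1 + fps_X) ^ (2 * i * j + i + j) / (1 - fps_X) ^ (2 * i * j + i + j + 1)))"
    (is "fps_const ?c + ?R = _")
    unfolding delannoy_def[symmetric]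
  proof (rule fps_ext)
    fix n
    show "(fps_const ?c + ?R) $ n = x_outermost (gf2 (\<lambda>i j. delannoy (2 * i * j + i + j))) $ n"
    proof (cases "n = 0")
      case True
      then show ?thesis unfolding x_outermost_nth const by simp
    next
      case False
      then have "n \<ge> 1" by simp
      then show ?thesis unfolding x_outermost_nth P_lpk_ilpk_gf2[OF \<open>n \<ge> 1\<close>, symmetric] by simp
    qed
  qed
next
  fix n :: nat assume "n \<ge> 1"
  from P_lpk_ilpk_gf2[OF this]
  show "((1 + var_s) * (1 + var_t)) ^ n / ((1 - var_s) * (1 - var_t)) ^ (n + 1)
          * P_lpk_ilpk n (4 * var_s / (1 + var_s) ^ 2) (4 * var_t / (1 + var_t) ^ 2)
        = gf2 (\<lambda>i j. \<Sum>k=0..n.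
            of_nat (((2 * i * j + i + j) choose k)
                    * ((2 * i * j + i + j + n - k) choose (n - k))))"
    unfolding delannoy_nth .
next
  fix n :: nat assume "n \<ge> 1"
  from P_lpk_ilpk_gf2[OF this]
  show "((1 + var_s) * (1 + var_t)) ^ n / ((1 - var_s) * (1 - var_t)) ^ (n + 1)
          * P_lpk_ilpk n (4 * var_s / (1 + var_s) ^ 2) (4 * var_t / (1 + var_t) ^ 2)
        = fps_const (fps_const (1 / fact n))
          * (\<Sum>k=0..n. of_nat (e_odd n k)
              * (eval_poly2 (eulerian_B k) var_s * eval_poly2 (eulerian_B k) var_t
                 / ((1 - var_s) ^ (k + 1) * (1 - var_t) ^ (k + 1))))"
    unfolding eulerian_B_product_gf2 gf2_delannoy_e_odd .
qed

end
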